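(* Let $A$ be an AW*-factor of type $\mathrm{II}_1$ with quasi-trace $Q:A\to\mathbb{C}$, and let $e\in A$ be an idempotent (i.e. $e^2=e$, not necessarily self-adjoint). Then, for every $s\in GL(A)$, we have $$Q(s e s^{-1})=Q(e).$$
   Context: $GL(A)$ denotes the group of invertible elements of $A$. An AW*-algebra is a C*-algebra in which the right annihilator of every subset has the form $pA$ for some projection $p$. An AW*-factor is an AW*-algebra with center $\mathbb{C}1$. It is of type $\mathrm{II}_1$ if it is finite ($x^*x=1$ implies $xx^*=1$) and has no nonzero abelian projections (for a projection $p\neq 0$, $pAp$ is never commutative). Notation: $\mathcal{P}(A)=\{p\in A: p=p^*=p^2\}$. For $p,q\in\mathcal{P}(A)$, $p\sim q$ means there is $x\in A$ with $p=x^*x$, $q=xx^*$ (Murray-von Neumann equivalence), and $p\perp q$ means $pq=0$. Dimension function: an AW*-factor $A$ of type $\mathrm{II}_1$ has a unique function $D:\mathcal{P}(A)\to[0,1]$ such that $D(p)=D(q)\Leftrightarrow p\sim q$; $D(p+q)=D(p)+D(q)$ whenever $p\perp q$; and $D(1)=1$. Quasi-trace: if $a=a^*\in A$ has finite spectrum, write $a=\sum_{k=1}^n\alpha_kp_k$ with $\alpha_k\in\mathbb{R}$ and $p_k$ pairwise orthogonal projections, and put $d(a)=\sum_{k=1}^n\alpha_kD(p_k)$. For arbitrary $a=a^*\in A$, put $q(a)=\lim_{n\to\infty}d(a_n)$, where $(a_n)$ is any sequence of self-adjoint elements with finite spectrum in the AW*-subalgebra $\{a\}''$ generated by $a$ and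 $1$, converging to $a$ in norm (the limit exists and is independent of the choice of the sequence). For arbitrary $x\in A$, put $Q(x)=q(\mathrm{Re}\,x)+i\,q(\mathrm{Im}\,x)$, where $\mathrm{Re}\,x=\frac12(x+x^* )$ and $\mathrm{Im}\,x=\frac1{2i}(x-x^* )$. The map $Q:A\to\mathbb{C}$ is called the quasi-trace of $A$; it is the unique map such that (i) $Q$ is linear on abelian C*-subalgebras of $A$; (ii) $Q(x^*x)=Q(xx^* )\ge 0$ for all $x\in A$; (iii) $Q(x)=Q(\mathrm{Re}\,x)+iQ(\mathrm{Im}\,x)$ for all $x\in A$; (iv) $Q(1)=1$. One has $Q|_{\mathcal{P}(A)}=D$. ($Q$ is not assumed to be linear on $A$.) *)

theory Defs
  imports Complex_Main
begin

text \<open>Requiring \<^class>\<open>real_normed_algebra_1\<close> makes the algebra unital and nonzero; neither is a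
  restriction below: an AW*-algebra has a unit (apply the annihilator condition to the empty set,
  and take adjoints), and a dimension function with \<open>D 1 = 1\<close> excludes the zero algebra.\<close>

class cstar_algebra = real_normed_algebra_1 + banach +
  fixes scaleC :: "complex \<Rightarrow> 'a \<Rightarrow> 'a"  (infixr "*\<^sub>C" 75)
    and star :: "'a \<Rightarrow> 'a"
  assumes scaleC_add_right: "c *\<^sub>C (x + y) = c *\<^sub>C x + c *\<^sub>C y"
    and scaleC_add_left: "(b + c) *\<^sub>C x = b *\<^sub>C x + c *\<^sub>C x"
    and scaleC_scaleC: "b *\<^sub>C c *\<^sub>C x = (b * c) *\<^sub>C x"
    and scaleC_of_real: "complex_of_real r *\<^sub>C x = r *\<^sub>R x"
    and mult_scaleC_left: "(c *\<^sub>C x) * y = c *\<^sub>C (x * y)"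
    and mult_scaleC_right: "x * (c *\<^sub>C y) = c *\<^sub>C (x * y)"
    and norm_scaleC: "norm (c *\<^sub>C x) = cmod c * norm x"
    and star_add: "star (x + y) = star x + star y"
    and star_scaleC: "star (c *\<^sub>C x) = cnj c *\<^sub>C star x"
    and star_mult: "star (x * y) = star y * star x"
    and star_star: "star (star x) = x"
    and cstar_identity: "norm (star x * x) = (norm x)\<^sup>2"
begin

definition projections :: "'a set"
  where "projections = {p. p = star p \<and> p = p * p}"

definition right_annihilator :: "'a set \<Rightarrow> 'a set"
  where "right_annihilator S = {a. \<forall>s\<in>S. s * a = 0}"

definition center :: "'a set"
  where "center = {z. \<forall>x. z * x = x * z}"

definition corner :: "'a \<Rightarrow> 'a set"
  where "corner p = {p * x * p | x. True}"

definition abelian_projection :: "'a \<Rightarrow> bool"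
  where "abelian_projection p \<longleftrightarrow>
    p \<in> projections \<and> (\<forall>x\<in>corner p. \<forall>y\<in>corner p. x * y = y * x)"

definition mvn_equiv :: "'a \<Rightarrow> 'a \<Rightarrow> bool"
  where "mvn_equiv p q \<longleftrightarrow> (\<exists>x. p = star x * x \<and> q = x * star x)"

definition GL :: "'a set"
  where "GL = {s. \<exists>t. s * t = 1 \<and> t * s = 1}"

definition GL_inverse :: "'a \<Rightarrow> 'a"
  where "GL_inverse s = (THE t. s * t = 1 \<and> t * s = 1)"

definition spectrum :: "'a \<Rightarrow> complex set"
  where "spectrum a = {c. c *\<^sub>C 1 - a \<notin> GL}"

definition commutant :: "'a set \<Rightarrow> 'a set"
  where "commutant S = {x. \<forall>y\<in>S. x * y = y * x}"

definition re_part :: "'a \<Rightarrow> 'a"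
  where "re_part x = (1 / 2) *\<^sub>C (x + star x)"

definition im_part :: "'a \<Rightarrow> 'a"
  where "im_part x = (1 / (2 * \<i>)) *\<^sub>C (x - star x)"

end

class aw_star_algebra = cstar_algebra +
  assumes right_annihilator_principal:
    "\<exists>p\<in>projections. right_annihilator S = {p * x | x. True}"

class aw_star_factor = aw_star_algebra +
  assumes center_scalars: "center = {c *\<^sub>C 1 | c. True}"

class aw_star_factor_II1 = aw_star_factor +
  assumes finite_algebra: "star x * x = 1 \<Longrightarrow> x * star x = 1"
    and no_abelian_projection: "abelian_projection p \<Longrightarrow> p = 0"

text \<open>A dimension function is a function on projections: its values elsewhere are arbitrary and
  are never used.\<close>

definition dimension_function :: "('a::aw_star_factor_II1 \<Rightarrow> real) \<Rightarrow> bool"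
  where "dimension_function D \<longleftrightarrow>
    (\<forall>p\<in>projections. 0 \<le> D p \<and> D p \<le> 1) \<and>
    (\<forall>p\<in>projections. \<forall>q\<in>projections. D p = D q \<longleftrightarrow> mvn_equiv p q) \<and>
    (\<forall>p\<in>projections. \<forall>q\<in>projections. p * q = 0 \<longrightarrow> D (p + q) = D p + D q) \<and>
    D 1 = 1"

definition simple_trace :: "('a::aw_star_factor_II1 \<Rightarrow> real) \<Rightarrow> 'a \<Rightarrow> real"
  where "simple_trace D a = (THE t. \<exists>(n::nat) \<alpha> p.
    (\<forall>k\<in>{1..n}. p k \<in> projections) \<and>
    (\<forall>j\<in>{1..n}. \<forall>k\<in>{1..n}. j \<noteq> k \<longrightarrow> p j * p k = 0) \<and>
    a = (\<Sum>k=1..n. \<alpha> k *\<^sub>R p k) \<and>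
    t = (\<Sum>k=1..n. \<alpha> k * D (p k)))"

text \<open>The AW*-subalgebra generated by a self-adjoint \<open>a\<close> and \<open>1\<close> is the bicommutant of \<open>a\<close>
  inside the algebra.\<close>

definition simple_approximation :: "'a::aw_star_factor_II1 \<Rightarrow> (nat \<Rightarrow> 'a) \<Rightarrow> bool"
  where "simple_approximation a X \<longleftrightarrow>
    (\<forall>n. star (X n) = X n \<and> finite (spectrum (X n)) \<and> X n \<in> commutant (commutant {a})) \<and>
    X \<longlonglongrightarrow> a"

definition selfadjoint_trace :: "('a::aw_star_factor_II1 \<Rightarrow> real) \<Rightarrow> 'a \<Rightarrow> real"
  where "selfadjoint_trace D a =
    (THE l. \<forall>X. simple_approximation a X \<longrightarrow> (\<lambda>n. simple_trace D (X n)) \<longlonglongrightarrow> l)"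

definition is_quasi_trace :: "('a::aw_star_factor_II1 \<Rightarrow> complex) \<Rightarrow> bool"
  where "is_quasi_trace Q \<longleftrightarrow> (\<exists>D. dimension_function D \<and>
    (\<forall>x. Q x = complex_of_real (selfadjoint_trace D (re_part x))
              + \<i> * complex_of_real (selfadjoint_trace D (im_part x))))"

end

theory Submission
  imports Defs "HOL-Computational_Algebra.Formal_Power_Series"
begin

text \<open>
  Let \<open>p\<close> be the range projection of an idempotent \<open>e\<close>, so \<open>pe = e\<close> and \<open>ep = p\<close>. The value
  \<open>Q(e)\<close> turns out to be \<open>D(p)\<close>, although \<open>Q\<close> need not be additive. With \<open>J = 2p - 1\<close> one has
  \<open>Re e = p + c\<close>, where \<open>c\<close> and \<open>Im e\<close> anticommute with the symmetry \<open>J\<close>. Conjugation by \<open>J\<close> turns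
  \<open>Im e\<close> into its negative, hence \<open>q(Im e) = 0\<close>. If \<open>c = \<sigma>|c|\<close> with support \<open>r = \<sigma>\<^sup>2\<close>, then
  \<open>p + c = p(1 - r) + r/2 + m\<close> with commuting summands, and conjugation by the unitary
  \<open>J\<sigma> + (1 - r)\<close> turns \<open>m\<close> into its negative, so \<open>q(m) = 0\<close>; moreover \<open>\<sigma>\<close> implements
  \<open>pr \<sim> (1 - p)r\<close>, so \<open>D(r)/2 = D(pr)\<close>. Finally the range projections of \<open>e\<close> and \<open>s e s\<^sup>-\<^sup>1\<close> are
  equivalent, by polar decomposition of \<open>sp\<close>.

  Square roots come from the binomial series, which converges absolutely on the closed unit ball;
  if \<open>k\<close> is a self-adjoint contraction, then \<open>k + i(1 - k\<^sup>2)\<^sup>1\<^sup>/\<^sup>2\<close> is unitary, and this replaces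
  the use of the spectrum in the theory of positive elements. Well-definedness of \<open>q\<close> rests on
  \<open>|d(x) - d(y)| \<le> \<parallel>x - y\<parallel>\<close> for commuting self-adjoint \<open>x, y\<close> with finite spectrum.
\<close>

section \<open>Involution and commutants\<close>

lemma star_scaleR: "star (r *\<^sub>R x) = r *\<^sub>R star (x :: 'a::cstar_algebra)"
  using star_scaleC[of "complex_of_real r" x] by (simp add: scaleC_of_real)

lemma star_0 [simp]: "star (0 :: 'a::cstar_algebra) = 0"
  using star_scaleR[of 0 "0 :: 'a"] by simp

lemma star_minus: "star (- x) = - star (x :: 'a::cstar_algebra)"
  using star_scaleR[of "- 1" x] by simp

lemma star_diff: "star (x - y) = star x - star (y :: 'a::cstar_algebra)"
  using star_add[of x "- y"] by (simp add: star_minus)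

lemma star_1 [simp]: "star (1 :: 'a::cstar_algebra) = 1"
  by (metis mult.right_neutral mult.left_neutral star_mult star_star)

lemma star_sum: "star (sum f I) = (\<Sum>i\<in>I. star (f i :: 'a::cstar_algebra))"
  by (induction I rule: infinite_finite_induct) (auto simp: star_add)

lemma star_power: "star (x ^ n) = star (x :: 'a::cstar_algebra) ^ n"
  by (induction n) (auto simp: star_mult power_commutes)

lemma norm_le_norm_star: "norm x \<le> norm (star (x :: 'a::cstar_algebra))"
proof (cases "x = 0")
  case False
  have "norm x * norm x \<le> norm (star x) * norm x"
    using norm_mult_ineq[of "star x" x] by (simp add: cstar_identity power2_eq_square)
  then show ?thesis using False by simp
qed simp

lemma norm_star [simp]: "norm (star x) = norm (x :: 'a::cstar_algebra)"
  using norm_le_norm_star[of x] norm_le_norm_star[of "star x"] by (simp add: star_star)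

lemma bounded_linear_star: "bounded_linear (star :: 'a::cstar_algebra \<Rightarrow> 'a)"
  by (rule bounded_linear_intro[where K = 1]) (auto simp: star_add star_scaleR)

lemma scaleC_1 [simp]: "1 *\<^sub>C x = (x :: 'a::cstar_algebra)"
  using scaleC_of_real[of 1 x] by simp

lemma scaleC_minus_left: "(- c) *\<^sub>C x = - (c *\<^sub>C (x :: 'a::cstar_algebra))"
  using scaleC_scaleC[of "- 1" c x] scaleC_of_real[of "- 1" "c *\<^sub>C x"] by simp

lemma scaleC_minus_right: "c *\<^sub>C (- x) = - (c *\<^sub>C (x :: 'a::cstar_algebra))"
  using scaleC_scaleC[of c "- 1" x] scaleC_of_real[of "- 1" x]
  by (simp add: scaleC_minus_left)

lemma scaleC_diff_right: "c *\<^sub>C (x - y) = c *\<^sub>C x - c *\<^sub>C (y :: 'a::cstar_algebra)"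
  using scaleC_add_right[of c x "- y"] by (simp add: scaleC_minus_right)

lemma norm_selfadjoint_square:
  assumes "star x = (x :: 'a::cstar_algebra)"
  shows "norm (x * x) = (norm x)\<^sup>2"
  using cstar_identity[of x] assms by simp

lemma GL_inverse_mult:
  assumes "s \<in> (GL :: 'a::cstar_algebra set)"
  shows "s * GL_inverse s = 1" and "GL_inverse s * s = 1"
proof -
  obtain t where t: "s * t = 1" "t * s = 1" using assms by (auto simp: GL_def)
  have "GL_inverse s = t"
    unfolding GL_inverse_def
  proof (rule the_equality)
    fix t' assume "s * t' = 1 \<and> t' * s = 1"
    then show "t' = t" using t by (metis mult.assoc mult.left_neutral mult.right_neutral)
  qed (use t in simp)
  then show "s * GL_inverse s = 1" "GL_inverse s * s = 1" using t by auto
qed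

section \<open>Bicommutants, in the role of the functions of one element\<close>

abbreviation bicommutant :: "'a::cstar_algebra \<Rightarrow> 'a set"
  where "bicommutant a \<equiv> commutant (commutant {a})"

lemma bicommutantI: "(\<And>y. y * a = a * y \<Longrightarrow> y * x = x * y) \<Longrightarrow> x \<in> bicommutant a"
  by (auto simp: commutant_def)

lemma bicommutantD: "x \<in> bicommutant a \<Longrightarrow> y * a = a * y \<Longrightarrow> y * x = x * y"
  by (auto simp: commutant_def)

lemma commutes_mult: "y * a = a * y \<Longrightarrow> y * b = b * y \<Longrightarrow> y * (a * b) = (a * b) * (y :: 'a::ring)"
  by (metis mult.assoc)

lemma commutes_power: "y * a = a * y \<Longrightarrow> y * a ^ n = a ^ n * (y :: 'a::ring_1)"
  by (induction n) (auto simp: commutes_mult)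

lemma commutes_star: "y * a = a * y \<Longrightarrow> star y * star a = star a * star (y :: 'a::cstar_algebra)"
  by (metis star_mult)

lemma bicommutant_commute:
  assumes "x \<in> bicommutant a" "y \<in> bicommutant a"
  shows "x * y = y * x"
proof -
  have "x * a = a * x" using bicommutantD[OF assms(1), of a] by simp
  then show ?thesis using bicommutantD[OF assms(2)] by blast
qed

lemma bicommutant_trans:
  assumes "x \<in> bicommutant a" "y \<in> bicommutant x"
  shows "y \<in> bicommutant a"
  using assms by (meson bicommutantD bicommutantI)

section \<open>Square roots and positivity\<close>

text \<open>After the constant term 1 all coefficients of the series are nonpositive, and its
  partial sums at x = 1 are nonnegative; hence the remaining coefficients have total absolute value
  at most 1. The convolution is Vandermonde's identity for the exponents 1/2 + 1/2 = 1.\<close>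

lemma sqrt_coefficients:
  fixes c :: "nat \<Rightarrow> real"
  defines "c \<equiv> \<lambda>k. (1 / 2 gchoose k) * (- 1) ^ k"
  shows "summable (\<lambda>k. \<bar>c k\<bar>)" and "summable (\<lambda>k. \<bar>c (Suc k)\<bar>)" and "(\<Sum>k. \<bar>c (Suc k)\<bar>) \<le> 1"
    and "(\<Sum>i\<le>n. c i * c (n - i)) = (if n = 0 then 1 else if n = 1 then - 1 else 0)"
proof -
  have neg: "c (Suc k) \<le> 0" for k
  proof -
    have "c (Suc k) = pochhammer (- 1 / 2) (Suc k) / fact (Suc k)"
      unfolding c_def gbinomial_pochhammer
      by (simp add: power_mult_distrib[symmetric] mult.assoc[symmetric] mult.commute)
    also have "\<dots> = - (1 / 2) * (pochhammer (1 / 2) k / fact (Suc k))"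
      by (simp add: pochhammer_rec)
    also have "\<dots> \<le> 0"
    proof -
      have "0 \<le> pochhammer (1 / 2 :: real) k / fact (Suc k)"
        by (intro divide_nonneg_pos less_imp_le pochhammer_pos) auto
      then show ?thesis by linarith
    qed
    finally show ?thesis .
  qed
  have part: "(\<Sum>k\<le>m. c k) \<ge> 0" for m
  proof -
    have "(\<Sum>k\<le>m. c k) = (- 1) ^ m * (- 1 / 2 gchoose m)"
      unfolding c_def gbinomial_sum_lower_neg by simp
    also have "\<dots> = pochhammer (1 / 2) m / fact m"
      unfolding gbinomial_pochhammer
      by (simp add: power_mult_distrib[symmetric] mult.assoc[symmetric] mult.commute)
    also have "\<dots> \<ge> 0" by (intro divide_nonneg_pos less_imp_le pochhammer_pos) auto
    finally show ?thesis .
  qed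
  have bound: "(\<Sum>k<m. \<bar>c (Suc k)\<bar>) \<le> 1" for m
  proof -
    have "(\<Sum>k<m. \<bar>c (Suc k)\<bar>) = - (\<Sum>k<m. c (Suc k))"
      using neg by (simp add: abs_of_nonpos sum_negf)
    also have "\<dots> = c 0 - (\<Sum>k\<le>m. c k)"
      using sum.lessThan_Suc_shift[of c m] by (simp add: lessThan_Suc_atMost)
    also have "\<dots> \<le> 1" using part[of m] by (simp add: c_def)
    finally show ?thesis .
  qed
  show s: "summable (\<lambda>k. \<bar>c (Suc k)\<bar>)"
    by (rule summableI_nonneg_bounded[where x = 1]) (use bound in auto)
  then show "summable (\<lambda>k. \<bar>c k\<bar>)" by (subst (asm) summable_Suc_iff)
  show "(\<Sum>k. \<bar>c (Suc k)\<bar>) \<le> 1" using s bound by (rule suminf_le_const)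
  have "(\<Sum>i\<le>n. c i * c (n - i)) = (- 1) ^ n * (\<Sum>i=0..n. (1 / 2 gchoose i) * (1 / 2 gchoose (n - i)))"
    unfolding c_def sum_distrib_left atMost_atLeast0
  proof (rule sum.cong[OF refl])
    fix i assume "i \<in> {0..n}"
    then have "(- 1 :: real) ^ n = (- 1) ^ i * (- 1) ^ (n - i)" by (simp flip: power_add)
    then show "((1 / 2 gchoose i) * (- 1) ^ i) * ((1 / 2 gchoose (n - i)) * (- 1) ^ (n - i))
      = (- 1 :: real) ^ n * ((1 / 2 gchoose i) * (1 / 2 gchoose (n - i)))" by simp
  qed
  also have "\<dots> = (- 1) ^ n * (1 gchoose n)" by (subst gbinomial_Vandermonde) simp
  also have "(1 gchoose n :: real) = of_nat (1 choose n)" by (simp add: binomial_gbinomial)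
  also have "(- 1) ^ n * of_nat (1 choose n) = (if n = 0 then 1 else if n = 1 then - 1 else 0 :: real)"
    by (cases n) auto
  finally show "(\<Sum>i\<le>n. c i * c (n - i)) = (if n = 0 then 1 else if n = 1 then - 1 else 0)" .
qed

text \<open>The series converges absolutely up to and including norm 1. The root is presented as
  \<open>1 - y\<close> because the bound on \<open>y\<close> keeps it close to a scalar, which later
  yields positivity of the root.\<close>

lemma sqrt_one_minus:
  fixes x :: "'a::cstar_algebra"
  assumes "norm x \<le> 1"
  obtains y where "norm y \<le> 1" "(1 - y) * (1 - y) = 1 - x" "star x = x \<longrightarrow> star y = y"
    "y \<in> bicommutant x"
proof -
  define c :: "nat \<Rightarrow> real" where "c k = (1 / 2 gchoose k) * (- 1) ^ k" for k
  note coef = sqrt_coefficients[folded c_def]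
  define f where "f k = c k *\<^sub>R x ^ k" for k
  have le: "norm (f k) \<le> \<bar>c k\<bar>" for k
  proof -
    have "norm (x ^ k) \<le> 1"
      by (rule order_trans[OF norm_power_ineq]) (simp add: assms power_le_one)
    then show ?thesis unfolding f_def by (simp add: mult_left_le)
  qed
  have sn: "summable (\<lambda>k. norm (f k))"
    by (rule summable_comparison_test'[OF coef(1)]) (use le in auto)
  have sf: "summable f" using sn by (rule summable_norm_cancel)
  define y where "y = - (\<Sum>k. f (Suc k))"
  have ss: "summable (\<lambda>k. f (Suc k))" using sf by (subst summable_Suc_iff)
  have one: "1 - y = (\<Sum>k. f k)"
  proof -
    have "f 0 = 1" by (simp add: f_def c_def)
    then show ?thesis using suminf_split_head[OF sf] by (simp add: y_def)
  qed
  have "norm y \<le> (\<Sum>k. norm (f (Suc k)))"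
    unfolding y_def norm_minus_cancel by (rule summable_norm) (use sn in \<open>subst summable_Suc_iff\<close>)
  also have "\<dots> \<le> (\<Sum>k. \<bar>c (Suc k)\<bar>)"
    by (rule suminf_le) (use sn le coef(2) summable_Suc_iff[of "\<lambda>k. norm (f k)"] in auto)
  also have "\<dots> \<le> 1" by (rule coef(3))
  finally have n: "norm y \<le> 1" .
  have "(\<Sum>i\<le>k. f i * f (k - i)) = (\<Sum>i\<le>k. c i * c (k - i)) *\<^sub>R x ^ k" for k
    unfolding scaleR_sum_left
    by (rule sum.cong[OF refl]) (auto simp: f_def simp flip: power_add)
  then have "(\<lambda>k. (\<Sum>i\<le>k. c i * c (k - i)) *\<^sub>R x ^ k) sums ((1 - y) * (1 - y))"
    using Cauchy_product_sums[OF sn sn] by (simp add: one)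
  moreover have "(\<lambda>k. (\<Sum>i\<le>k. c i * c (k - i)) *\<^sub>R x ^ k) sums
      (\<Sum>k\<in>{0,1}. (\<Sum>i\<le>k. c i * c (k - i)) *\<^sub>R x ^ k)"
    by (rule sums_finite) (auto simp: coef(4))
  ultimately have sq: "(1 - y) * (1 - y) = (\<Sum>k\<in>{0,1}. (\<Sum>i\<le>k. c i * c (k - i)) *\<^sub>R x ^ k)"
    by (rule sums_unique2)
  have sq: "(1 - y) * (1 - y) = 1 - x" unfolding sq coef(4) by simp
  have sa: "star y = y" if "star x = x"
    using bounded_linear.suminf[OF bounded_linear_star ss] that
    by (simp add: y_def star_minus f_def star_scaleR star_power del: power_Suc)
  have "y \<in> bicommutant x"
  proof (rule bicommutantI)
    fix z assume z: "z * x = x * z"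
    have "z * (\<Sum>k. f (Suc k)) = (\<Sum>k. z * f (Suc k))" by (rule suminf_mult[symmetric, OF ss])
    also have "\<dots> = (\<Sum>k. f (Suc k) * z)" using commutes_power[OF z] by (simp add: f_def del: power_Suc)
    also have "\<dots> = (\<Sum>k. f (Suc k)) * z" by (rule suminf_mult2[symmetric, OF ss])
    finally show "z * y = y * z" by (simp add: y_def)
  qed
  with n sq sa show ?thesis using that by blast
qed

text \<open>The norm hypothesis is positivity of \<open>h\<close> in disguise. Applying the series
  to 1 - h/t gives a root that satisfies the same condition with \<open>sqrt t\<close>, so the root
  is positive as well.\<close>

lemma sqrt_near_scalar:
  fixes h :: "'a::cstar_algebra"
  assumes "star h = h" "norm (t *\<^sub>R 1 - h) \<le> t"
  obtains w where "star w = w" "w * w = h" "w \<in> bicommutant h" "norm (sqrt t *\<^sub>R 1 - w) \<le> sqrt t"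
proof (cases "t = 0")
  case True
  then have "h = 0" using assms by simp
  then show ?thesis using that[of 0] True by (auto simp: commutant_def)
next
  case False
  then have t: "t > 0" using assms(2) norm_ge_zero by (metis less_eq_real_def order_trans)
  define x where "x = 1 - h /\<^sub>R t"
  have "x = (t *\<^sub>R 1 - h) /\<^sub>R t" using t by (simp add: x_def scaleR_diff_right)
  then have "norm x = norm (t *\<^sub>R 1 - h) / t" using t by (simp add: divide_inverse mult.commute)
  then have "norm x \<le> 1" using assms(2) t by simp
  then obtain y where y: "norm y \<le> 1" "(1 - y) * (1 - y) = 1 - x" "star x = x \<longrightarrow> star y = y"
    "y \<in> bicommutant x" by (rule sqrt_one_minus)
  have sy: "star y = y" using y(3) by (simp add: x_def star_diff star_scaleR assms)
  have xh: "x \<in> bicommutant h" by (rule bicommutantI) (simp add: x_def algebra_simps)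
  show ?thesis
  proof (rule that)
    show "star (sqrt t *\<^sub>R (1 - y)) = sqrt t *\<^sub>R (1 - y)" by (simp add: star_diff star_scaleR sy)
    show "(sqrt t *\<^sub>R (1 - y)) * (sqrt t *\<^sub>R (1 - y)) = h"
      using t by (simp add: y(2) x_def flip: mult.assoc)
    show "sqrt t *\<^sub>R (1 - y) \<in> bicommutant h"
      by (rule bicommutantI) (use bicommutantD[OF bicommutant_trans[OF xh y(4)]] in \<open>simp add: algebra_simps\<close>)
    show "norm (sqrt t *\<^sub>R 1 - sqrt t *\<^sub>R (1 - y)) \<le> sqrt t"
      using t y(1) by (simp add: scaleR_diff_right mult_left_le)
  qed
qed

section \<open>Norm bounds obtained from unitaries\<close>

lemma norm_projection:
  assumes "p \<in> (projections :: 'a::cstar_algebra set)" "p \<noteq> 0"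
  shows "norm p = 1"
proof -
  have "norm p = (norm p)\<^sup>2" using assms(1) cstar_identity[of p] by (auto simp: projections_def)
  then show ?thesis using assms(2) by (simp add: power2_eq_square)
qed

lemma norm_contraction_square:
  fixes k :: "'a::cstar_algebra"
  assumes "star k = k" "norm k \<le> 1"
  shows "norm (1 - 2 *\<^sub>R (k * k)) \<le> 1"
proof -
  have "norm (k * k) \<le> 1" using assms by (simp add: norm_selfadjoint_square power_le_one)
  then obtain y where y: "(1 - y) * (1 - y) = 1 - k * k"
    "star (k * k) = k * k \<longrightarrow> star y = y" "y \<in> bicommutant (k * k)"
    by (rule sqrt_one_minus)
  define w where "w = 1 - y"
  have w: "w * w = 1 - k * k" "star w = w" using y(1,2) by (simp_all add: w_def star_diff star_mult assms)
  have kw: "k * w = w * k"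
    using bicommutantD[OF y(3), of k] by (simp add: w_def algebra_simps)
  \<comment> \<open>\<open>k\<close> is the real part of a unitary \<open>u\<close>, so \<open>2k\<^sup>2 - 1\<close> is the real part of \<open>u\<^sup>2\<close>.\<close>
  define u where "u = k + \<i> *\<^sub>C w"
  have su: "star u = k - \<i> *\<^sub>C w"
    by (simp add: u_def star_add star_scaleC assms w scaleC_minus_left)
  have "star u * u = k * k + w * w"
    by (simp only: su, simp add: u_def algebra_simps mult_scaleC_left mult_scaleC_right scaleC_scaleC scaleC_minus_left
        scaleC_diff_right scaleC_add_right kw)
  then have "(norm u)\<^sup>2 = 1" using cstar_identity[of u] by (simp add: w)
  then have nu: "norm u = 1" by (simp add: power2_eq_1_iff) (smt (verit) norm_ge_zero)
  have "u * u + star u * star u = 2 *\<^sub>R (k * k) - 2 *\<^sub>R (w * w)"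
    by (simp only: su, simp add: u_def algebra_simps mult_scaleC_left mult_scaleC_right scaleC_scaleC scaleC_minus_left
        scaleC_diff_right scaleC_add_right kw scaleR_2)
  also have "\<dots> = - 2 *\<^sub>R (1 - 2 *\<^sub>R (k * k))" unfolding w
    by (simp add: scaleR_diff_right) (simp flip: scaleR_add_left)
  finally have "2 * norm (1 - 2 *\<^sub>R (k * k)) = norm (u * u + star u * star u)" by simp
  also have "\<dots> \<le> norm u * norm u + norm (star u) * norm (star u)"
    by (intro order_trans[OF norm_triangle_ineq] add_mono norm_mult_ineq)
  finally show ?thesis by (simp add: nu)
qed

text \<open>Division by \<open>sqrt t\<close> reduces this to a contraction. The scalar t/2 is the
  midpoint of [0, t]; having the radius t/2 here, and not t, is what later halves the error in the
  spectral approximation.\<close>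

lemma norm_half_minus_square:
  fixes k :: "'a::cstar_algebra"
  assumes "star k = k" "norm (k * k) \<le> t"
  shows "norm ((t / 2) *\<^sub>R 1 - k * k) \<le> t / 2"
proof (cases "t = 0")
  case True
  then show ?thesis using assms by simp
next
  case False
  then have t: "t > 0" using assms(2) norm_ge_zero by (metis less_eq_real_def order_trans)
  define m where "m = k /\<^sub>R sqrt t"
  have "star m = m" by (simp add: m_def star_scaleR assms)
  moreover have mm: "m * m = (k * k) /\<^sub>R t" using t by (simp add: m_def flip: inverse_mult_distrib)
  moreover have "norm m \<le> 1"
  proof -
    have "(norm m)\<^sup>2 = norm (m * m)" using calculation(1) by (simp add: norm_selfadjoint_square)
    also have "\<dots> \<le> 1" unfolding mm using assms(2) t by (simp add: divide_simps)
    finally show ?thesis using power2_le_imp_le[of "norm m" 1] by simp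
  qed
  ultimately have "norm (1 - 2 *\<^sub>R ((k * k) /\<^sub>R t)) \<le> 1" using norm_contraction_square by metis
  moreover have "(t / 2) *\<^sub>R 1 - k * k = (t / 2) *\<^sub>R (1 - 2 *\<^sub>R ((k * k) /\<^sub>R t))"
    using t by (simp add: scaleR_diff_right)
  ultimately show ?thesis using t by (simp add: mult_left_le)
qed

section \<open>Positive elements\<close>

text \<open>The definition is by squares, but sums are handled through the norm form
  \<open>norm (t *\<^sub>R 1 - h) \<le> t\<close>; \<open>positive_near_scalar\<close> and
  \<open>near_scalar_positive\<close> pass between the two.\<close>

definition positive :: "'a::cstar_algebra \<Rightarrow> bool"
  where "positive h \<longleftrightarrow> (\<exists>k. star k = k \<and> h = k * k)"

lemma positive_selfadjoint: "positive h \<Longrightarrow> star h = h"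
  by (auto simp: positive_def star_mult)

lemma positive_near_scalar:
  assumes "positive h" "norm h \<le> t"
  shows "norm (t *\<^sub>R 1 - h) \<le> t"
proof -
  have "norm ((t / 2) *\<^sub>R 1 - h) \<le> t / 2"
    using norm_half_minus_square assms unfolding positive_def by blast
  moreover have eq: "t *\<^sub>R 1 - h = (t / 2) *\<^sub>R 1 + ((t / 2) *\<^sub>R 1 - h)"
    by (simp add: add_diff_eq flip: scaleR_add_left)
  moreover have "norm ((t / 2) *\<^sub>R (1 :: 'a)) = t / 2"
    using order_trans[OF norm_ge_zero assms(2)] by simp
  ultimately show ?thesis
    unfolding eq using norm_triangle_ineq[of "(t / 2) *\<^sub>R 1" "(t / 2) *\<^sub>R 1 - h"] by linarith
qed

lemma positive_sqrt:
  assumes "positive h"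
  obtains w where "star w = w" "w * w = h" "w \<in> bicommutant h"
  using sqrt_near_scalar[OF positive_selfadjoint[OF assms] positive_near_scalar[OF assms order_refl]]
  by blast

lemma near_scalar_positive:
  assumes "star h = h" "norm (t *\<^sub>R 1 - h) \<le> t"
  shows "positive h"
  using sqrt_near_scalar[OF assms] unfolding positive_def by metis

text \<open>In norm form the two conditions simply add up by the triangle inequality.\<close>

lemma positive_add:
  assumes "positive g" "positive h"
  shows "positive (g + h)"
proof (rule near_scalar_positive)
  show "star (g + h) = g + h" using assms by (simp add: star_add positive_selfadjoint)
  have "(norm g + norm h) *\<^sub>R 1 - (g + h) = (norm g *\<^sub>R 1 - g) + (norm h *\<^sub>R 1 - h)"
    by (simp add: algebra_simps)
  also have "norm \<dots> \<le> norm g + norm h"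
    by (intro order_trans[OF norm_triangle_ineq] add_mono positive_near_scalar assms order_refl)
  finally show "norm ((norm g + norm h) *\<^sub>R 1 - (g + h)) \<le> norm g + norm h" .
qed

lemma positive_scaleR:
  assumes "positive h" "0 \<le> t"
  shows "positive (t *\<^sub>R h)"
proof -
  obtain k where "star k = k" "h = k * k" using assms(1) by (auto simp: positive_def)
  then have "star (sqrt t *\<^sub>R k) = sqrt t *\<^sub>R k" "t *\<^sub>R h = (sqrt t *\<^sub>R k) * (sqrt t *\<^sub>R k)"
    using assms(2) by (auto simp: star_scaleR)
  then show ?thesis unfolding positive_def by blast
qed

text \<open>The element u = k + iw satisfies \<open>star u * u = t *\<^sub>R 1\<close>, so its norm
  is the square root of |t|, and this bounds the norm of its real part \<open>k\<close>.\<close>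

lemma norm_summand_of_scalar:
  fixes k w :: "'a::cstar_algebra"
  assumes "star k = k" "star w = w" "k * w = w * k" "k * k + w * w = t *\<^sub>R 1"
  shows "(norm k)\<^sup>2 \<le> \<bar>t\<bar>"
proof -
  define u where "u = k + \<i> *\<^sub>C w"
  have su: "star u = k - \<i> *\<^sub>C w"
    by (simp add: u_def star_add star_scaleC assms scaleC_minus_left)
  have "star u * u = k * k + w * w"
    by (simp only: su, simp add: u_def algebra_simps mult_scaleC_left mult_scaleC_right scaleC_scaleC scaleC_minus_left
        scaleC_diff_right scaleC_add_right assms(3) del: assms(4))
  then have nu: "(norm u)\<^sup>2 = \<bar>t\<bar>" using cstar_identity[of u] by (simp add: assms(4))
  have "u + star u = 2 *\<^sub>R k" by (simp add: su, simp add: u_def scaleR_2)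
  then have "2 * norm k = norm (u + star u)" by simp
  also have "\<dots> \<le> norm u + norm u" using norm_triangle_ineq[of u "star u"] by simp
  finally have "norm k \<le> norm u" by simp
  then show ?thesis using nu by (metis norm_ge_zero power_mono)
qed

lemma positive_norm_le:
  assumes "positive h" "positive (t *\<^sub>R 1 - h)"
  shows "norm h \<le> \<bar>t\<bar>"
proof -
  obtain k where k: "star k = k" "h = k * k" using assms(1) by (auto simp: positive_def)
  obtain w where w: "star w = w" "w * w = t *\<^sub>R 1 - h" "w \<in> bicommutant (t *\<^sub>R 1 - h)"
    using positive_sqrt[OF assms(2)] .
  have "k * w = w * k" by (rule bicommutantD[OF w(3)]) (simp add: k algebra_simps)
  then have "(norm k)\<^sup>2 \<le> \<bar>t\<bar>" by (rule norm_summand_of_scalar[OF k(1) w(1)]) (simp add: w k)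
  then show ?thesis by (simp add: k norm_selfadjoint_square)
qed

text \<open>The core of the positivity of \<open>x * star x\<close>. With h = k^2 of norm T,
  \<open>star z * z\<close> turns out to be positive of norm T. Expanding z (T -
  \<open>star z * z\<close>) \<open>star z\<close> then bounds the norm of Th + h^2 by T^2, whereas
  positivity of h would force the value 2T^2.\<close>

lemma mult_star_eq_minus_square:
  fixes z k :: "'a::cstar_algebra"
  assumes "z * star z = - (k * k)" "star k = k"
  shows "k = 0"
proof (rule ccontr)
  assume "k \<noteq> 0"
  define h where "h = k * k"
  have h: "positive h" "star h = h" using assms(2) by (auto simp: h_def positive_def star_mult)
  define T where "T = norm h"
  have zz: "z * star z = - h" using assms(1) by (simp add: h_def)
  have Tz: "T = norm z * norm z"
    using cstar_identity[of "star z"] by (simp add: star_star zz T_def power2_eq_square)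
  have T: "T > 0" using \<open>k \<noteq> 0\<close> by (simp add: T_def h_def norm_selfadjoint_square assms)
  \<comment> \<open>The squares of \<open>z + star z\<close> and of \<open>v\<close> below are
    positive and add up to twice \<open>star z * z + z * star z\<close>.\<close>
  have sq: "positive ((z + star z) * (z + star z))"
    unfolding positive_def by (intro exI[of _ "z + star z"]) (simp add: star_add star_star add.commute)
  define v where "v = \<i> *\<^sub>C (z - star z)"
  have "star v = v"
    by (simp add: v_def star_scaleC star_diff star_star scaleC_minus_left flip: scaleC_minus_right)
  then have "positive (v * v)" unfolding positive_def by blast
  with sq have "positive ((z + star z) * (z + star z) + v * v)" by (rule positive_add)
  moreover have "v * v = - ((z - star z) * (z - star z))"
    using scaleC_minus_left[of 1 "(z - star z) * (z - star z)"]
    by (simp add: v_def mult_scaleC_left mult_scaleC_right scaleC_scaleC)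
  then have "(z + star z) * (z + star z) + v * v = 2 *\<^sub>R (star z * z - h)"
    by (simp add: algebra_simps scaleR_2 zz)
  ultimately have "positive (2 *\<^sub>R (star z * z - h))" by simp
  from positive_scaleR[OF this, of "1 / 2"] have "positive (star z * z - h)" by simp
  from positive_add[OF this h(1)] have pos: "positive (star z * z)" by simp
  have na: "norm (star z * z) = T" by (simp add: cstar_identity Tz power2_eq_square)
  have "z * (T *\<^sub>R 1 - star z * z) * star z = T *\<^sub>R (z * star z) - (z * star z) * (z * star z)"
    by (simp add: algebra_simps)
  also have "\<dots> = - (T *\<^sub>R h + h * h)" by (simp add: zz)
  finally have "norm (T *\<^sub>R h + h * h) = norm (z * (T *\<^sub>R 1 - star z * z) * star z)"
    by (simp only: norm_minus_cancel)
  also have "\<dots> \<le> norm z * norm (T *\<^sub>R 1 - star z * z) * norm (star z)"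
    by (intro order_trans[OF norm_mult_ineq] mult_right_mono norm_mult_ineq norm_ge_zero)
  also have "\<dots> \<le> norm z * T * norm z"
    using positive_near_scalar[OF pos, of T] na by (simp add: mult_left_mono mult_right_mono)
  finally have bound: "norm (T *\<^sub>R h + h * h) \<le> T\<^sup>2"
    by (simp add: Tz power2_eq_square mult_ac)
  \<comment> \<open>Completing the square turns the bound into a norm of \<open>g\<close> below
    3T/2, although h + T/2 should have norm exactly T + T/2.\<close>
  define g where "g = h + (T / 2) *\<^sub>R 1"
  have sg: "star g = g" by (simp add: g_def star_add star_scaleR h)
  have "g * g = (T *\<^sub>R h + h * h) + (T\<^sup>2 / 4) *\<^sub>R 1"
  proof -
    have "(T / 2) *\<^sub>R h + (T / 2) *\<^sub>R h = T *\<^sub>R h" by (simp flip: scaleR_add_left)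
    then show ?thesis by (simp add: g_def algebra_simps power2_eq_square)
  qed
  then have "(norm g)\<^sup>2 \<le> norm (T *\<^sub>R h + h * h) + norm ((T\<^sup>2 / 4) *\<^sub>R (1 :: 'a))"
    using norm_triangle_ineq norm_selfadjoint_square[OF sg] by metis
  also have "\<dots> \<le> 5 / 4 * T\<^sup>2" using bound by simp
  also have "\<dots> < (3 / 2 * T)\<^sup>2" using T by (simp add: power_mult_distrib power2_eq_square)
  finally have ng: "norm g < 3 / 2 * T" by (rule power2_less_imp_less) (use T in simp)
  have "positive (norm g *\<^sub>R 1 - g)"
    by (rule near_scalar_positive[where t = "norm g"]) (auto simp: star_diff star_scaleR sg)
  then have "positive ((norm g - T / 2) *\<^sub>R 1 - h)" by (simp add: g_def algebra_simps)
  from positive_norm_le[OF h(1) this] have "T \<le> \<bar>norm g - T / 2\<bar>" by (simp add: T_def)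
  moreover have "norm g \<ge> 0" by simp
  ultimately show False using ng T by arith
qed

section \<open>Kernel and support projections\<close>

definition support_projection :: "'a::cstar_algebra \<Rightarrow> 'a \<Rightarrow> bool"
  where "support_projection x g \<longleftrightarrow> g \<in> projections \<and> x * g = x \<and> (\<forall>y. x * y = 0 \<longrightarrow> g * y = 0)"

lemma projectionsD: "p \<in> projections \<Longrightarrow> star p = p" "p \<in> projections \<Longrightarrow> p * p = p"
  by (auto simp: projections_def)

lemma projectionsI: "star p = p \<Longrightarrow> p * p = p \<Longrightarrow> p \<in> projections"
  by (auto simp: projections_def)

lemma support_projectionD:
  assumes "support_projection x g"
  shows "g \<in> projections" "star g = g" "g * g = g" "x * g = x" "x * y = 0 \<Longrightarrow> g * y = 0"
  using assms projectionsD by (auto simp: support_projection_def)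

definition kernel_projection :: "'a::cstar_algebra \<Rightarrow> 'a \<Rightarrow> bool"
  where "kernel_projection x p \<longleftrightarrow> p \<in> projections \<and> (\<forall>y. x * y = 0 \<longleftrightarrow> p * y = y)"

lemma kernel_projectionD:
  assumes "kernel_projection x p"
  shows "p \<in> projections" "star p = p" "p * p = p" "x * p = 0" "x * y = 0 \<longleftrightarrow> p * y = y"
  using assms projectionsD by (auto simp: kernel_projection_def)

lemma kernel_projection_unique:
  assumes "kernel_projection x p" "kernel_projection x q"
  shows "p = q"
proof -
  note p = kernel_projectionD[OF assms(1)] and q = kernel_projectionD[OF assms(2)]
  have "p * q = q" "q * p = p" using p q by blast+
  then show ?thesis using p(2) q(2) by (metis star_mult)
qed

text \<open>An element z commuting with \<open>x\<close> preserves the kernel of \<open>x\<close>,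
  so pzp = zp. Using this for \<open>y\<close> and for \<open>star y\<close> gives py = yp.\<close>

lemma kernel_projection_bicommutant:
  assumes "kernel_projection x p" "star x = x"
  shows "p \<in> bicommutant x"
proof (rule bicommutantI)
  note p = kernel_projectionD[OF assms(1)]
  fix y assume y: "y * x = x * y"
  have *: "p * (z * p) = z * p" if "z * x = x * z" for z
    using that p(4) unfolding p(5)[symmetric] by (metis mult.assoc mult_zero_right)
  have "star y * x = x * star y" using commutes_star[OF y] assms(2) by simp
  from *[OF this] have "star (p * (star y * p)) = star (star y * p)" by simp
  then have "p * (y * p) = p * y" by (simp add: star_mult star_star p mult.assoc)
  with *[OF y] show "y * p = p * y" by simp
qed

lemma kernel_projection_exists:
  fixes x :: "'a::aw_star_algebra"
  obtains p where "kernel_projection x p"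
proof -
  obtain p where p: "p \<in> projections" "right_annihilator {x} = {p * y | y. True}"
    using right_annihilator_principal by blast
  have "x * y = 0 \<longleftrightarrow> p * y = y" for y
  proof -
    have "x * y = 0 \<longleftrightarrow> y \<in> right_annihilator {x}" by (simp add: right_annihilator_def)
    also have "\<dots> \<longleftrightarrow> y \<in> {p * y | y. True}" by (simp only: p(2))
    also have "\<dots> \<longleftrightarrow> p * y = y"
    proof
      assume "y \<in> {p * y | y. True}"
      then obtain z where "y = p * z" by blast
      then show "p * y = y" by (simp add: projectionsD(2)[OF p(1)] flip: mult.assoc)
    next
      assume "p * y = y"
      then have "y = p * y" ..
      then show "y \<in> {p * y | y. True}" by blast
    qed
    finally show ?thesis .
  qed
  with p(1) have "kernel_projection x p" by (simp add: kernel_projection_def)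
  then show ?thesis by (rule that)
qed

lemma support_projection_exists:
  fixes x :: "'a::aw_star_algebra"
  assumes "star x = x"
  obtains g where "support_projection x g" "g \<in> bicommutant x"
proof -
  obtain p where p: "kernel_projection x p" by (rule kernel_projection_exists)
  note pp = kernel_projectionD[OF p]
  show ?thesis
  proof (rule that)
    show "support_projection x (1 - p)"
      unfolding support_projection_def
      using pp(5) by (auto intro!: projectionsI simp: star_diff algebra_simps pp(1-4))
    show "1 - p \<in> bicommutant x"
      by (rule bicommutantI)
        (use bicommutantD[OF kernel_projection_bicommutant[OF p assms]] in \<open>simp add: algebra_simps\<close>)
  qed
qed

lemma support_projection_unique:
  assumes "support_projection x g" "support_projection x g'"
  shows "g = g'"
proof -
  have "x * (1 - g') = 0" "x * (1 - g) = 0"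
    using support_projectionD(4)[OF assms(1)] support_projectionD(4)[OF assms(2)]
    by (simp_all add: algebra_simps)
  then have "g * (1 - g') = 0" "g' * (1 - g) = 0"
    using support_projectionD(5)[OF assms(1)] support_projectionD(5)[OF assms(2)] by blast+
  then have *: "g = g * g'" "g' = g' * g" by (simp_all add: algebra_simps)
  have "g = star g" using support_projectionD(2)[OF assms(1)] by simp
  also have "\<dots> = star (g * g')" using *(1) by simp
  also have "\<dots> = g' * g"
    using support_projectionD(2)[OF assms(1)] support_projectionD(2)[OF assms(2)] by (simp add: star_mult)
  finally show ?thesis using *(2) by simp
qed

lemma support_projection_conjugate:
  assumes "support_projection x g" "star J = J" "J * J = 1"
  shows "support_projection (J * x * J) (J * g * J)"
proof -
  note g = support_projectionD[OF assms(1)]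
  have JJ: "J * (J * y) = y" for y using assms(3) by (metis mult.assoc mult.left_neutral)
  have gg: "g * (g * y) = g * y" for y using g(3) by (metis mult.assoc)
  have xg: "x * (g * y) = x * y" for y using g(4) by (metis mult.assoc)
  show ?thesis unfolding support_projection_def
  proof (intro conjI allI impI)
    show "J * g * J \<in> projections"
      by (rule projectionsI) (simp_all add: star_mult assms g mult.assoc JJ gg)
    show "J * x * J * (J * g * J) = J * x * J" by (simp add: mult.assoc JJ xg)
    fix y assume "J * x * J * y = 0"
    then have "J * (J * (x * (J * y))) = 0" by (simp add: mult.assoc)
    then have "x * (J * y) = 0" by (simp add: JJ)
    then show "J * g * J * y = 0" using g(5) by (simp add: mult.assoc)
  qed
qed

section \<open>Absolute values and positivity of \<open>x * star x\<close>\<close>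

text \<open>Here \<open>h\<close> is |c|, and \<open>g1\<close>, \<open>g2\<close> are the supports
  of the positive and the negative part of \<open>c\<close>. They are orthogonal because (h + c)(h -
  c) = h^2 - c^2 = 0. The equation for \<open>2 *\<^sub>R (h * g1)\<close> is the polar form c = h(2
  g1 - 1).\<close>

lemma absolute_value:
  fixes c :: "'a::aw_star_algebra"
  assumes "star c = c"
  obtains h g1 g2 where "positive h" "h * h = c * c" "h \<in> bicommutant (c * c)"
    "support_projection (h + c) g1" "support_projection (h - c) g2" "g1 * g2 = 0" "g2 * g1 = 0"
    "g1 \<in> bicommutant c" "g2 \<in> bicommutant c"
    "2 *\<^sub>R (h * g1) = h + c" "h * g1 = c * g1" "h * g2 = - (c * g2)"
proof -
  define t where "t = norm (c * c)"
  have "positive (c * c)" using assms unfolding positive_def by blast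
  from positive_near_scalar[OF this, of t] have "norm (t *\<^sub>R 1 - c * c) \<le> t" by (simp add: t_def)
  moreover have "star (c * c) = c * c" by (simp add: star_mult assms)
  ultimately obtain h where h: "star h = h" "h * h = c * c" "h \<in> bicommutant (c * c)"
    "norm (sqrt t *\<^sub>R 1 - h) \<le> sqrt t"
    using sqrt_near_scalar by blast
  \<comment> \<open>The root is itself close to a scalar; this singles out the positive
    root.\<close>
  have pos: "positive h" using h by (intro near_scalar_positive)
  have ch: "c * h = h * c" by (rule bicommutantD[OF h(3)]) (simp add: mult.assoc)
  obtain g1 where g1: "support_projection (h + c) g1" "g1 \<in> bicommutant (h + c)"
    by (rule support_projection_exists[of "h + c"]) (simp_all add: star_add h assms)
  obtain g2 where g2: "support_projection (h - c) g2" "g2 \<in> bicommutant (h - c)"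
    by (rule support_projection_exists[of "h - c"]) (simp_all add: star_diff h assms)
  have hc: "y * h = h * y" if "y * c = c * y" for y
    by (rule bicommutantD[OF h(3)]) (metis that mult.assoc)
  have "(h - c) * (h + c) = 0" "(h + c) * (h - c) = 0" by (simp_all add: algebra_simps h ch)
  then have 0: "g2 * (h + c) = 0" "g1 * (h - c) = 0"
    using support_projectionD(5)[OF g1(1)] support_projectionD(5)[OF g2(1)] by blast+
  then have "star (g2 * (h + c)) = 0" "star (g1 * (h - c)) = 0" by simp_all
  then have 00: "(h + c) * g2 = 0" "(h - c) * g1 = 0"
    by (simp_all add: star_mult star_add star_diff h assms support_projectionD(2)[OF g1(1)] support_projectionD(2)[OF g2(1)])
  then have g12: "g1 * g2 = 0" "g2 * g1 = 0"
    using support_projectionD(5)[OF g1(1)] support_projectionD(5)[OF g2(1)] by blast+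
  have hg: "h * g1 = c * g1" "h * g2 = - (c * g2)"
    using 00 by (simp_all add: algebra_simps add_eq_0_iff)
  have "(h + c) * g1 = h + c" "(h - c) * g2 = h - c"
    using support_projectionD(4)[OF g1(1)] support_projectionD(4)[OF g2(1)] by auto
  then have hh: "2 *\<^sub>R (h * g1) = h + c"
    using hg by (simp_all add: algebra_simps scaleR_2)
  show ?thesis
  proof (rule that[OF pos h(2,3) g1(1) g2(1) g12 _ _ hh hg])
    show "g1 \<in> bicommutant c"
      by (rule bicommutantI, rule bicommutantD[OF g1(2)]) (simp add: hc algebra_simps)
    show "g2 \<in> bicommutant c"
      by (rule bicommutantI, rule bicommutantD[OF g2(2)]) (simp add: hc algebra_simps)
  qed
qed

text \<open>Let \<open>l\<close> be the root of |c|. Cutting \<open>x\<close> down by the support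
  \<open>g2\<close> of the negative part gives z = g2 x with \<open>z * star z\<close> equal to
  minus the square of \<open>l * g2\<close>, so the negative part vanishes by
  \<open>mult_star_eq_minus_square\<close>.\<close>

lemma positive_mult_star: "positive (x * star x)" for x :: "'a::aw_star_algebra"
proof -
  define c where "c = x * star x"
  have sc: "star c = c" by (simp add: c_def star_mult star_star)
  then obtain h g1 g2 where h: "positive h" "h * h = c * c" "h \<in> bicommutant (c * c)"
    "support_projection (h + c) g1" "support_projection (h - c) g2"
    "g2 \<in> bicommutant c" "h * g2 = - (c * g2)"
    using absolute_value by metis
  note g = support_projectionD[OF h(5)]
  have "h * c = c * h" using bicommutantD[OF h(3), of c] by (simp add: mult.assoc)
  then have hg: "h * g2 = g2 * h" by (rule bicommutantD[OF h(6)])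
  obtain l where l: "star l = l" "l * l = h" "l \<in> bicommutant h" using positive_sqrt[OF h(1)] .
  have lg: "g2 * l = l * g2" using bicommutantD[OF l(3), of g2] hg by simp
  have "(g2 * x) * star (g2 * x) = g2 * (c * g2)" by (simp add: star_mult c_def g mult.assoc)
  also have "\<dots> = - (g2 * (l * l * g2))" using h(7) l(2) by (simp add: minus_equation_iff)
  also have "\<dots> = - ((l * g2) * (l * g2))" by (metis lg mult.assoc g(3))
  finally have "l * g2 = 0"
    by (rule mult_star_eq_minus_square) (simp add: star_mult l g lg)
  then have "h * g2 = 0" using l(2) by (metis mult.assoc mult_zero_right)
  moreover from this have "c * g2 = 0" using h(7) by simp
  ultimately have "h - c = 0" using g(4) by (metis diff_self left_diff_distrib)
  then show ?thesis using h(1) by (simp add: c_def)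
qed

section \<open>Resolutions of the identity and spectral approximation\<close>

text \<open>The projections may be 0 and the values may repeat, so that commuting elements can share
  one family indexed by pairs. The total 1 makes scalars expressible over the same family.\<close>

definition resolution :: "'i set \<Rightarrow> ('i \<Rightarrow> real) \<Rightarrow> ('i \<Rightarrow> 'a::cstar_algebra) \<Rightarrow> 'a \<Rightarrow> bool"
  where "resolution I \<alpha> p x \<longleftrightarrow> finite I \<and> (\<forall>i\<in>I. p i \<in> projections) \<and>
    (\<forall>i\<in>I. \<forall>j\<in>I. i \<noteq> j \<longrightarrow> p i * p j = 0) \<and> sum p I = 1 \<and> x = (\<Sum>i\<in>I. \<alpha> i *\<^sub>R p i)"

lemma resolutionD:
  assumes "resolution I \<alpha> p x"
  shows "finite I" "i \<in> I \<Longrightarrow> p i \<in> projections" "i \<in> I \<Longrightarrow> p i * p i = p i"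
    "i \<in> I \<Longrightarrow> j \<in> I \<Longrightarrow> i \<noteq> j \<Longrightarrow> p i * p j = 0" "sum p I = 1" "x = (\<Sum>i\<in>I. \<alpha> i *\<^sub>R p i)"
  using assms projectionsD by (auto simp: resolution_def)

lemma orthogonal_sum_projection:
  assumes "\<And>i. i \<in> K \<Longrightarrow> p i \<in> (projections :: 'a::cstar_algebra set)"
    and "\<And>i j. i \<in> K \<Longrightarrow> j \<in> K \<Longrightarrow> i \<noteq> j \<Longrightarrow> p i * p j = 0"
  shows "sum p K \<in> projections"
proof (cases "finite K")
  case True
  have "p i * sum p K = p i" if "i \<in> K" for i
  proof -
    have "p i * sum p K = (\<Sum>j\<in>K. if j = i then p i else 0)"
      unfolding sum_distrib_left by (rule sum.cong) (use that assms in \<open>auto simp: projectionsD\<close>)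
    then show ?thesis using True that by simp
  qed
  then have "sum p K * sum p K = sum p K" by (simp add: sum_distrib_right)
  then show ?thesis using assms(1) by (intro projectionsI) (simp_all add: star_sum projectionsD)
qed (simp add: projections_def)

lemma resolution_mult_projection:
  assumes "resolution I \<alpha> p x" "j \<in> I"
  shows "x * p j = \<alpha> j *\<^sub>R p j" "p j * x = \<alpha> j *\<^sub>R p j"
proof -
  note r = resolutionD[OF assms(1)]
  have "x * p j = (\<Sum>i\<in>I. if i = j then \<alpha> j *\<^sub>R p j else 0)"
    unfolding r(6) sum_distrib_right by (rule sum.cong) (use assms r in auto)
  then show "x * p j = \<alpha> j *\<^sub>R p j" using r(1) assms by simp
  have "p j * x = (\<Sum>i\<in>I. if i = j then \<alpha> j *\<^sub>R p j else 0)"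
    unfolding r(6) sum_distrib_left by (rule sum.cong) (use assms r in auto)
  then show "p j * x = \<alpha> j *\<^sub>R p j" using r(1) assms by simp
qed

lemma resolution_selfadjoint: "resolution I \<alpha> p x \<Longrightarrow> star x = x"
  by (auto simp: resolution_def star_sum star_scaleR projectionsD)

lemma resolution_change:
  assumes "resolution I \<alpha> p x" "y = (\<Sum>i\<in>I. \<beta> i *\<^sub>R p i)"
  shows "resolution I \<beta> p y"
  using assms by (auto simp: resolution_def)

lemma resolution_add:
  assumes "resolution I \<alpha> p x" "resolution I \<beta> p y"
  shows "resolution I (\<lambda>i. \<alpha> i + \<beta> i) p (x + y)"
  by (rule resolution_change[OF assms(1)])
    (simp add: scaleR_add_left sum.distrib flip: resolutionD(6)[OF assms(1)] resolutionD(6)[OF assms(2)])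

lemma resolution_mult:
  assumes "resolution I \<alpha> p x" "resolution I \<beta> p y"
  shows "resolution I (\<lambda>i. \<alpha> i * \<beta> i) p (x * y)"
proof (rule resolution_change[OF assms(1)])
  have "x * y = (\<Sum>i\<in>I. \<beta> i *\<^sub>R (x * p i))"
    by (subst resolutionD(6)[OF assms(2)]) (simp add: sum_distrib_left)
  also have "\<dots> = (\<Sum>i\<in>I. (\<alpha> i * \<beta> i) *\<^sub>R p i)"
    by (rule sum.cong) (auto simp: resolution_mult_projection[OF assms(1)] mult.commute)
  finally show "x * y = (\<Sum>i\<in>I. (\<alpha> i * \<beta> i) *\<^sub>R p i)" .
qed

lemma resolution_const: "resolution I \<alpha> p x \<Longrightarrow> resolution I (\<lambda>_. t) p (t *\<^sub>R 1)"
  by (rule resolution_change, assumption) (simp add: resolution_def flip: scaleR_sum_right)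

text \<open>The monic polynomial with roots \<open>ls\<close>, evaluated at \<open>x\<close>. One
  list can be evaluated both at an algebra element and at its real spectral values.\<close>

definition shift_product :: "real list \<Rightarrow> 'a::real_algebra_1 \<Rightarrow> 'a"
  where "shift_product ls x = prod_list (map (\<lambda>l. x - l *\<^sub>R 1) ls)"

lemma shift_product_simps [simp]:
  "shift_product [] x = 1" "shift_product (l # ls) x = (x - l *\<^sub>R 1) * shift_product ls x"
  by (auto simp: shift_product_def)

lemma resolution_shift_product:
  assumes "resolution I \<alpha> p x"
  shows "resolution I (\<lambda>i. shift_product ls (\<alpha> i)) p (shift_product ls x)"
proof (induction ls)
  case Nil
  then show ?case using resolution_const[OF assms, of 1] by simp
next
  case (Cons l ls)
  have "resolution I (\<lambda>i. \<alpha> i - l) p (x - l *\<^sub>R 1)"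
    using resolution_add[OF assms resolution_const[OF assms, of "- l"]] by simp
  from resolution_mult[OF this Cons] show ?case by simp
qed

lemma tendsto_shift_product:
  fixes x :: "'a::real_normed_algebra_1"
  assumes "(f \<longlongrightarrow> x) F"
  shows "((\<lambda>n. shift_product ls (f n)) \<longlongrightarrow> shift_product ls x) F"
  by (induction ls) (auto intro!: tendsto_intros assms)

lemma shift_product_eq_0: "shift_product ls (x :: real) = 0 \<longleftrightarrow> x \<in> set ls"
  by (induction ls) auto

lemma commutes_shift_product: "y * x = x * y \<Longrightarrow> y * shift_product ls x = shift_product ls x * y"
proof (induction ls)
  case (Cons l ls)
  show ?case unfolding shift_product_simps
    by (rule commutes_mult) (use Cons in \<open>auto simp: algebra_simps\<close>)
qed simp

text \<open>A companion \<open>w\<close> over the same family, with coefficients chosen so that x^2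
  + w^2 = B^2, brings the claim under \<open>norm_summand_of_scalar\<close>.\<close>

lemma resolution_norm_le:
  assumes r: "resolution I \<alpha> p x" and le: "\<And>i. i \<in> I \<Longrightarrow> p i \<noteq> 0 \<Longrightarrow> \<bar>\<alpha> i\<bar> \<le> B" and "0 \<le> B"
  shows "norm x \<le> B"
proof -
  \<comment> \<open>The bound is given only where \<open>p i\<close> is nonzero; the other values
    are reset to 0, so that the square roots below have nonnegative arguments.\<close>
  define \<beta> where "\<beta> i = (if p i = 0 then 0 else \<alpha> i)" for i
  have b: "resolution I \<beta> p x"
    by (rule resolution_change[OF r], subst resolutionD(6)[OF r], rule sum.cong) (auto simp: \<beta>_def)
  have "\<bar>\<beta> i\<bar> \<le> B" if "i \<in> I" for i using le[OF that] assms(3) by (auto simp: \<beta>_def)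
  then have sq: "(\<beta> i)\<^sup>2 \<le> B\<^sup>2" if "i \<in> I" for i 
    using that order_trans[OF _ abs_ge_self[of B]] by (simp add: abs_le_square_iff[symmetric])
  define w where "w = (\<Sum>i\<in>I. sqrt (B\<^sup>2 - (\<beta> i)\<^sup>2) *\<^sub>R p i)"
  have w: "resolution I (\<lambda>i. sqrt (B\<^sup>2 - (\<beta> i)\<^sup>2)) p w"
    using r by (rule resolution_change) (simp add: w_def)
  have "x * w = w * x"
    using resolutionD(6)[OF resolution_mult[OF b w]] resolutionD(6)[OF resolution_mult[OF w b]]
    by (simp add: mult.commute)
  moreover have "x * x + w * w = B\<^sup>2 *\<^sub>R 1"
  proof -
    have "x * x + w * w = (\<Sum>i\<in>I. (\<beta> i * \<beta> i + sqrt (B\<^sup>2 - (\<beta> i)\<^sup>2) * sqrt (B\<^sup>2 - (\<beta> i)\<^sup>2)) *\<^sub>R p i)"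
      by (rule resolutionD(6)[OF resolution_add[OF resolution_mult[OF b b] resolution_mult[OF w w]]])
    also have "\<dots> = (\<Sum>i\<in>I. B\<^sup>2 *\<^sub>R p i)"
      by (rule sum.cong) (use sq in \<open>auto simp: power2_eq_square\<close>)
    also have "\<dots> = B\<^sup>2 *\<^sub>R 1" by (simp add: resolutionD(5)[OF r] flip: scaleR_sum_right)
    finally show ?thesis .
  qed
  ultimately have "(norm x)\<^sup>2 \<le> \<bar>B\<^sup>2\<bar>"
    by (intro norm_summand_of_scalar[OF resolution_selfadjoint[OF r] resolution_selfadjoint[OF w]])
  then show ?thesis using assms(3) power2_le_imp_le[of "norm x" B] by simp
qed

section \<open>Eigenprojections and common resolutions\<close>

text \<open>Kernel projections are unique. They exist in every AW*-algebra, and in a general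
  C*-algebra at least for elements that have a resolution.\<close>

definition eigenprojection :: "'a::cstar_algebra \<Rightarrow> real \<Rightarrow> 'a"
  where "eigenprojection x l = (THE p. kernel_projection (x - l *\<^sub>R 1) p)"

lemma eigenprojection_eq: "kernel_projection (x - l *\<^sub>R 1) p \<Longrightarrow> eigenprojection x l = p"
  unfolding eigenprojection_def by (blast intro: kernel_projection_unique)

text \<open>Multiplying (x - l)y = 0 by \<open>p i\<close> shows that only indices with value
  \<open>l\<close> contribute to y. As the eigenprojection depends on \<open>x\<close> and
  \<open>l\<close> alone, any two resolutions of \<open>x\<close> can be compared through it; it is
  0 when \<open>l\<close> is not a value.\<close>

lemma resolution_eigenprojection:
  assumes "resolution I \<alpha> p x"
  shows "eigenprojection x l = (\<Sum>i\<in>{i\<in>I. \<alpha> i = l}. p i)"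
    and "kernel_projection (x - l *\<^sub>R 1) (eigenprojection x l)"
proof -
  note r = resolutionD[OF assms]
  define g where "g = (\<Sum>i\<in>{i\<in>I. \<alpha> i = l}. p i)"
  have "(x - l *\<^sub>R 1) * y = 0 \<longleftrightarrow> g * y = y" for y
  proof
    assume *: "(x - l *\<^sub>R 1) * y = 0"
    have "p i * y = 0" if "i \<in> I" "\<alpha> i \<noteq> l" for i
    proof -
      have "p i * ((x - l *\<^sub>R 1) * y) = (\<alpha> i - l) *\<^sub>R (p i * y)"
        using resolution_mult_projection(2)[OF assms that(1)]
        by (simp add: algebra_simps mult.assoc[symmetric])
      then show ?thesis using that * by simp
    qed
    then have "sum p I * y = g * y"
      unfolding g_def sum_distrib_right using r(1) by (intro sum.mono_neutral_right) auto
    then show "g * y = y" by (simp add: r(5))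
  next
    assume *: "g * y = y"
    have "x * g = l *\<^sub>R g"
      unfolding g_def sum_distrib_left scaleR_sum_right
      by (rule sum.cong) (auto simp: resolution_mult_projection[OF assms])
    then have "(x - l *\<^sub>R 1) * (g * y) = 0" by (simp add: algebra_simps mult.assoc[symmetric])
    then show "(x - l *\<^sub>R 1) * y = 0" by (simp add: *)
  qed
  moreover have "g \<in> projections" unfolding g_def by (rule orthogonal_sum_projection) (use r in auto)
  ultimately have k: "kernel_projection (x - l *\<^sub>R 1) g" by (simp add: kernel_projection_def)
  show "eigenprojection x l = g" using k by (rule eigenprojection_eq)
  with k show "kernel_projection (x - l *\<^sub>R 1) (eigenprojection x l)" by simp
qed

text \<open>Indexing the resolution by its own values avoids a quantification over index
  types.\<close>

definition resolved :: "'a::cstar_algebra \<Rightarrow> bool"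
  where "resolved x \<longleftrightarrow> (\<exists>L. resolution L (\<lambda>l. l) (eigenprojection x) x)"

lemma sum_fibres:
  fixes f :: "'b \<Rightarrow> 'c::comm_monoid_add"
  assumes "finite I"
  shows "(\<Sum>l\<in>\<alpha> ` I. \<Sum>i\<in>{i\<in>I. \<alpha> i = l}. f i) = sum f I"
  using assms by (simp add: sum.group)

lemma resolution_canonical:
  assumes "resolution I \<alpha> p x"
  shows "resolution (\<alpha> ` I) (\<lambda>l. l) (eigenprojection x) x"
proof -
  note r = resolutionD[OF assms]
  note e = resolution_eigenprojection[OF assms]
  have "sum (eigenprojection x) (\<alpha> ` I) = 1"
    unfolding e(1) sum_fibres[OF r(1)] by (rule r(5))
  moreover have "(\<Sum>l\<in>\<alpha> ` I. l *\<^sub>R eigenprojection x l) = x"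
  proof -
    have "(\<Sum>l\<in>\<alpha> ` I. l *\<^sub>R eigenprojection x l) = (\<Sum>l\<in>\<alpha> ` I. \<Sum>i\<in>{i\<in>I. \<alpha> i = l}. \<alpha> i *\<^sub>R p i)"
      unfolding e(1) scaleR_sum_right by (intro sum.cong) auto
    then show ?thesis unfolding sum_fibres[OF r(1)] r(6) .
  qed
  moreover have "eigenprojection x l * eigenprojection x m = 0" if "l \<noteq> m" for l m
    unfolding e(1) sum_product by (intro sum.neutral ballI) (use that r(4) in auto)
  moreover have "eigenprojection x l \<in> projections" for l using e(2) kernel_projectionD(1) by blast
  ultimately show ?thesis using r(1) by (auto simp: resolution_def)
qed

lemma resolvedI: "resolution I \<alpha> p x \<Longrightarrow> resolved x"
  unfolding resolved_def using resolution_canonical by blast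

lemma resolved_selfadjoint: "resolved x \<Longrightarrow> star x = x"
  unfolding resolved_def using resolution_selfadjoint by blast

text \<open>The common refinement consists of the products of eigenprojections. Those of
  \<open>x\<close> commute with those of \<open>y\<close>, because they lie in the bicommutants of
  the two commuting elements.\<close>

lemma resolved_common_resolution:
  assumes "resolved x" "resolved y" "x * y = y * x"
  obtains I :: "(real \<times> real) set" and \<alpha> \<beta> p where "resolution I \<alpha> p x" "resolution I \<beta> p y"
proof -
  obtain L where L: "resolution L (\<lambda>l. l) (eigenprojection x) x" using assms by (auto simp: resolved_def)
  obtain M where M: "resolution M (\<lambda>l. l) (eigenprojection y) y" using assms by (auto simp: resolved_def)
  note l = resolutionD[OF L] and m = resolutionD[OF M]
  define p where "p = (\<lambda>(a, b). eigenprojection x a * eigenprojection y b)"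
  have bic: "eigenprojection z a \<in> bicommutant z" if "resolution N (\<lambda>l. l) (eigenprojection z) z"
    for z :: 'a and N a
  proof -
    have "eigenprojection z a \<in> bicommutant (z - a *\<^sub>R 1)"
      by (rule kernel_projection_bicommutant[OF resolution_eigenprojection(2)[OF that]])
        (simp add: star_diff star_scaleR resolution_selfadjoint[OF that])
    from bicommutantD[OF this] show ?thesis by (intro bicommutantI) (simp add: algebra_simps)
  qed
  have c: "eigenprojection x a * eigenprojection y b = eigenprojection y b * eigenprojection x a" for a b
    by (metis bic[OF L] bic[OF M] assms(3) bicommutantD)
  have sum1: "(\<Sum>i\<in>L \<times> M. f (fst i) *\<^sub>R p i) = (\<Sum>a\<in>L. f a *\<^sub>R eigenprojection x a)" for f
  proof -
    have "(\<Sum>i\<in>L \<times> M. f (fst i) *\<^sub>R p i) = (\<Sum>a\<in>L. (f a *\<^sub>R eigenprojection x a) * sum (eigenprojection y) M)"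
      by (simp add: sum.cartesian_product p_def sum_distrib_left split_def)
    then show ?thesis by (simp add: m(5))
  qed
  have sum2: "(\<Sum>i\<in>L \<times> M. f (snd i) *\<^sub>R p i) = (\<Sum>b\<in>M. f b *\<^sub>R eigenprojection y b)" for f
  proof -
    have "(\<Sum>i\<in>L \<times> M. f (snd i) *\<^sub>R p i)
      = (\<Sum>a\<in>L. \<Sum>b\<in>M. eigenprojection x a * (f b *\<^sub>R eigenprojection y b))"
      by (simp add: sum.cartesian_product p_def split_def)
    also have "\<dots> = sum (eigenprojection x) L * (\<Sum>b\<in>M. f b *\<^sub>R eigenprojection y b)"
      unfolding sum_product ..
    finally show ?thesis by (simp add: l(5))
  qed
  have prod: "p (a, b) * p (a', b')
      = (eigenprojection x a * eigenprojection x a') * (eigenprojection y b * eigenprojection y b')" for a b a' b'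
    by (simp add: p_def mult.assoc) (simp add: c[of _ b] flip: mult.assoc)
  have "p i \<in> projections" if i: "i \<in> L \<times> M" for i
  proof -
    from i obtain a b where i: "i = (a, b)" "a \<in> L" "b \<in> M" by blast
    then have "p i * p i = p i" by (simp add: prod l(3) m(3)) (simp add: p_def)
    moreover have "star (p i) = p i"
      using i l(2) m(2) by (simp add: p_def star_mult projectionsD(1) c)
    ultimately show ?thesis by (intro projectionsI)
  qed
  moreover have "p i * p j = 0" if "i \<in> L \<times> M" "j \<in> L \<times> M" "i \<noteq> j" for i j
  proof -
    obtain a b a' b' where "i = (a, b)" "j = (a', b')" by (metis surj_pair)
    then show ?thesis using that l(4)[of a a'] m(4)[of b b'] by (cases "a = a'") (auto simp: prod)
  qed
  moreover have "sum p (L \<times> M) = 1" using sum1[of "\<lambda>_. 1"] l(5) by simp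
  ultimately have r: "resolution (L \<times> M) f p (\<Sum>i\<in>L \<times> M. f i *\<^sub>R p i)" for f
    using l(1) m(1) by (simp add: resolution_def)
  have "resolution (L \<times> M) fst p x" "resolution (L \<times> M) snd p y"
    using r[of fst] r[of snd] trans[OF sum1[of "\<lambda>a. a"] l(6)[symmetric]]
      trans[OF sum2[of "\<lambda>a. a"] m(6)[symmetric]] by simp_all
  then show ?thesis by (rule that)
qed

lemma resolved_add:
  assumes "resolved x" "resolved y" "x * y = y * x"
  shows "resolved (x + y)"
  by (metis resolved_common_resolution[OF assms] resolution_add resolvedI)

section \<open>Norm approximation by elements with a finite resolution\<close>

lemma resolution_symmetry:
  assumes "g \<in> projections"
  shows "resolution UNIV (\<lambda>b. if b then s else t) (\<lambda>b. if b then g else 1 - g) (s *\<^sub>R g + t *\<^sub>R (1 - g))"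
  using projectionsD[OF assms] assms
  by (auto simp: resolution_def UNIV_bool star_diff algebra_simps intro!: projectionsI)

text \<open>Each step halves the error bound r. The error is b = hJ with h = |b| and the sign
  symmetry J = 2g - 1; subtracting (r/2)J leaves (h - r/2)J, of norm at most r/2. All corrections
  lie in the bicommutant of \<open>a\<close>, hence commute, and so their sum is again
  resolved.\<close>

lemma resolved_approximation:
  fixes a :: "'a::aw_star_algebra"
  assumes "star a = a"
  shows "\<exists>x. resolved x \<and> x \<in> bicommutant a \<and> norm (a - x) \<le> norm a / 2 ^ n"
proof (induction n)
  case 0
  have "resolution {()} (\<lambda>_. 0) (\<lambda>_. 1) (0 :: 'a)" by (simp add: resolution_def projections_def)
  then show ?case by (intro exI[of _ 0]) (auto dest: resolvedI simp: commutant_def)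
next
  case (Suc n)
  then obtain x where x: "resolved x" "x \<in> bicommutant a" "norm (a - x) \<le> norm a / 2 ^ n" by blast
  define r where "r = norm a / 2 ^ n"
  define b where "b = a - x"
  have sb: "star b = b" by (simp add: b_def star_diff assms resolved_selfadjoint[OF x(1)])
  obtain h g where h: "positive h" "h * h = b * b" "support_projection (h + b) g" "g \<in> bicommutant b"
    "2 *\<^sub>R (h * g) = h + b"
    using absolute_value[OF sb] by metis
  note g = support_projectionD[OF h(3)]
  have "(norm h)\<^sup>2 = (norm b)\<^sup>2"
    using h(2) norm_selfadjoint_square[OF sb] norm_selfadjoint_square[OF positive_selfadjoint[OF h(1)]] by simp
  then have "norm h \<le> r" using x(3) by (simp add: b_def r_def)
  then have near: "norm ((r / 2) *\<^sub>R 1 - h) \<le> r / 2"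
    using norm_half_minus_square h(1) unfolding positive_def by blast
  define J where "J = 2 *\<^sub>R g - 1"
  have J: "star J = J" "J * J = 1"
    by (simp_all add: J_def star_diff star_add g algebra_simps scaleR_2)
  have nJ: "norm J = 1"
    using norm_selfadjoint_square[OF J(1)] by (simp add: J(2) power2_eq_1_iff) (smt (verit) norm_ge_zero)
  define y where "y = (r / 2) *\<^sub>R g + (- r / 2) *\<^sub>R (1 - g)"
  have yJ: "y = (r / 2) *\<^sub>R J"
  proof -
    have "(r / 2) *\<^sub>R g + (r / 2) *\<^sub>R g = r *\<^sub>R g" by (simp flip: scaleR_add_left)
    then show ?thesis by (simp add: y_def J_def algebra_simps)
  qed
  have "resolved y" unfolding y_def by (rule resolvedI[OF resolution_symmetry[OF g(1)]])
  have bb: "b \<in> bicommutant a"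
    by (rule bicommutantI) (use bicommutantD[OF x(2)] in \<open>simp add: b_def algebra_simps\<close>)
  have ga: "g \<in> bicommutant a" by (rule bicommutant_trans[OF bb h(4)])
  have ya: "y \<in> bicommutant a"
    by (rule bicommutantI) (use bicommutantD[OF ga] in \<open>simp add: yJ J_def algebra_simps\<close>)
  have "h * J = b" using h(5) by (simp add: J_def algebra_simps)
  then have "a - (x + y) = - (((r / 2) *\<^sub>R 1 - h) * J)" by (simp add: b_def[symmetric] yJ algebra_simps)
  then have "norm (a - (x + y)) \<le> norm ((r / 2) *\<^sub>R 1 - h) * norm J"
    by (simp only: norm_minus_cancel norm_mult_ineq)
  also have "\<dots> \<le> norm a / 2 ^ Suc n" using near by (simp add: nJ r_def)
  finally have "norm (a - (x + y)) \<le> norm a / 2 ^ Suc n" .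
  moreover have "resolved (x + y)"
    by (rule resolved_add[OF x(1) \<open>resolved y\<close> bicommutant_commute[OF x(2) ya]])
  moreover have "x + y \<in> bicommutant a"
    by (rule bicommutantI) (use bicommutantD[OF x(2)] bicommutantD[OF ya] in \<open>simp add: algebra_simps\<close>)
  ultimately show ?case by blast
qed

lemma resolved_sequence:
  fixes a :: "'a::aw_star_algebra"
  assumes "star a = a"
  obtains X where "\<And>n. resolved (X n)" "\<And>n. X n \<in> bicommutant a" "X \<longlonglongrightarrow> a"
proof -
  obtain X where X: "\<And>n. resolved (X n) \<and> X n \<in> bicommutant a \<and> norm (a - X n) \<le> norm a / 2 ^ n"
    using resolved_approximation[OF assms] by metis
  have "(\<lambda>n. norm a * (1 / 2) ^ n) \<longlonglongrightarrow> norm a * 0"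
    by (intro tendsto_intros LIMSEQ_power_zero) simp
  then have "(\<lambda>n. norm a / 2 ^ n) \<longlonglongrightarrow> 0" by (simp add: power_one_over)
  then have "(\<lambda>n. a - X n) \<longlonglongrightarrow> 0"
    by (rule tendsto_0_le[where K = 1]) (use X in auto)
  then have "(\<lambda>n. a - (a - X n)) \<longlonglongrightarrow> a - 0" by (intro tendsto_intros)
  then have "X \<longlonglongrightarrow> a" by simp
  then show ?thesis using that X by blast
qed

section \<open>Finite spectrum versus finite resolution\<close>

lemma resolved_finite_spectrum:
  assumes "resolved x"
  shows "finite (spectrum x)"
proof -
  obtain L where L: "resolution L (\<lambda>l. l) (eigenprojection x) x" using assms by (auto simp: resolved_def)
  note l = resolutionD[OF L]
  have "c *\<^sub>C 1 - x \<in> GL" if "c \<notin> complex_of_real ` L" for c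
  proof -
    \<comment> \<open>The inverse divides by \<open>c - l\<close> on each eigenprojection.\<close>
    define y where "y = (\<Sum>l\<in>L. (1 / (c - of_real l)) *\<^sub>C eigenprojection x l)"
    have eq: "(1 / (c - of_real l)) *\<^sub>C (c *\<^sub>C eigenprojection x l - l *\<^sub>R eigenprojection x l)
        = eigenprojection x l" if "l \<in> L" for l
    proof -
      have "c *\<^sub>C eigenprojection x l - l *\<^sub>R eigenprojection x l = (c - of_real l) *\<^sub>C eigenprojection x l"
        using scaleC_add_left[of c "- of_real l" "eigenprojection x l"]
        by (simp add: scaleC_minus_left scaleC_of_real)
      moreover have "c - of_real l \<noteq> 0" using that \<open>c \<notin> _\<close> by auto
      ultimately show ?thesis by (simp add: scaleC_scaleC)
    qed
    have "(c *\<^sub>C 1 - x) * y = (\<Sum>l\<in>L. eigenprojection x l)"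
      unfolding y_def sum_distrib_left
      by (rule sum.cong[OF refl], subst mult_scaleC_right)
        (simp add: left_diff_distrib mult_scaleC_left resolution_mult_projection[OF L] eq)
    moreover have "y * (c *\<^sub>C 1 - x) = (\<Sum>l\<in>L. eigenprojection x l)"
      unfolding y_def sum_distrib_right
      by (rule sum.cong[OF refl], subst mult_scaleC_left)
        (simp add: right_diff_distrib mult_scaleC_right resolution_mult_projection[OF L] eq)
    ultimately show ?thesis unfolding GL_def using l(5) by auto
  qed
  then have "spectrum x \<subseteq> complex_of_real ` L" by (auto simp: spectrum_def)
  then show ?thesis by (rule finite_subset) (simp add: l(1))
qed

text \<open>As in linear algebra, a polynomial with simple roots that annihilates \<open>x\<close>
  makes \<open>x\<close> diagonalisable.\<close>

lemma shift_product_eq_0_resolved: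
  fixes x :: "'a::aw_star_algebra"
  assumes "star x = x" "distinct ls" "shift_product ls x = 0"
  shows "resolved x"
proof -
  define e where "e = eigenprojection x"
  have ker: "kernel_projection (x - l *\<^sub>R 1) (e l)" for l
  proof -
    obtain p where p: "kernel_projection (x - l *\<^sub>R 1) p" by (rule kernel_projection_exists)
    then show ?thesis unfolding e_def eigenprojection_eq[OF p] .
  qed
  note k = kernel_projectionD[OF ker]
  have xe: "x * e l = l *\<^sub>R e l" for l using k(4)[of l] by (simp add: algebra_simps)
  have "star (x * e l) = star (l *\<^sub>R e l)" for l by (simp only: xe)
  then have ex: "e l * x = l *\<^sub>R e l" for l by (simp add: star_mult star_scaleR assms(1) k(2))
  have orth: "e l * e m = 0" if "l \<noteq> m" for l m
  proof -
    have "e l * (x * e m) = (e l * x) * e m" by (simp add: mult.assoc)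
    then have "m *\<^sub>R (e l * e m) = l *\<^sub>R (e l * e m)" by (simp add: xe ex)
    then show ?thesis using that by simp
  qed
  \<comment> \<open>Here \<open>y * z\<close> lies in the kernel of x - l, so \<open>y\<close>
    annihilates \<open>z - e l * z\<close>. The remaining roots therefore account for that
    difference, and orthogonality restores \<open>e l * z\<close>.\<close>
  have total: "sum e (set ls) * z = z" if "distinct ls" "shift_product ls x * z = 0" for z ls
    using that
  proof (induction ls arbitrary: z)
    case (Cons l ls)
    define y where "y = shift_product ls x"
    have "(x - l *\<^sub>R 1) * (y * z) = 0" using Cons.prems by (simp add: y_def mult.assoc)
    then have "e l * (y * z) = y * z" using k(5) by blast
    moreover have "e l * y = y * e l"
      unfolding y_def by (rule commutes_shift_product) (simp add: ex xe)
    ultimately have "y * (z - e l * z) = 0" by (simp add: algebra_simps) (metis mult.assoc)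
    then have "sum e (set ls) * (z - e l * z) = z - e l * z"
      using Cons by (simp add: y_def)
    moreover have "sum e (set ls) * e l = 0"
      unfolding sum_distrib_right by (intro sum.neutral ballI orth) (use Cons.prems in auto)
    then have "sum e (set ls) * (e l * z) = 0" by (metis mult.assoc mult_zero_left)
    ultimately have "sum e (set ls) * z = z - e l * z" by (simp add: algebra_simps)
    then show ?case using Cons.prems by (simp add: algebra_simps)
  qed simp
  have sum1: "sum e (set ls) = 1" using total[OF assms(2), of 1] assms(3) by simp
  have "x = x * sum e (set ls)" by (simp add: sum1)
  also have "\<dots> = (\<Sum>l\<in>set ls. l *\<^sub>R e l)" by (simp add: sum_distrib_left xe)
  finally have "resolution (set ls) (\<lambda>l. l) e x" using sum1 k(1) orth by (auto simp: resolution_def)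
  then show ?thesis by (rule resolvedI)
qed

text \<open>Let f have the real spectral values of \<open>x\<close> as roots. If f(x) were nonzero,
  resolved approximants of \<open>x\<close> would have eigenvalues at which f stays away from 0.
  These would accumulate at some m outside the spectrum, while the eigenprojections behave as
  approximate eigenvectors of \<open>x\<close> for m.\<close>

lemma finite_spectrum_resolved:
  fixes x :: "'a::aw_star_algebra"
  assumes sx: "star x = x" and fin: "finite (spectrum x)"
  shows "resolved x"
proof -
  define F where "F = {l :: real. of_real l \<in> spectrum x}"
  have "finite F" unfolding F_def
    using finite_vimageI[OF fin, of complex_of_real] by (simp add: inj_def vimage_def)
  then obtain ls where ls: "set ls = F" "distinct ls" using finite_distinct_list by blast
  let ?f = "shift_product ls"
  have "?f x = 0"
  proof (rule ccontr)
    assume "?f x \<noteq> 0"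
    define \<delta> where "\<delta> = norm (?f x) / 2"
    have "\<delta> > 0" "\<delta> < norm (?f x)" using \<open>?f x \<noteq> 0\<close> by (auto simp: \<delta>_def)
    obtain X where X: "\<And>n. resolved (X n)" "\<And>n. X n \<in> bicommutant x" "X \<longlonglongrightarrow> x"
      using resolved_sequence[OF sx] by blast
    have "(\<lambda>n. norm (?f (X n))) \<longlonglongrightarrow> norm (?f x)"
      by (intro tendsto_norm tendsto_shift_product X)
    then have "\<forall>\<^sub>F n in sequentially. \<delta> < norm (?f (X n))"
      using \<open>\<delta> < norm (?f x)\<close> by (rule order_tendstoD)
    then obtain N where N: "\<And>n. n \<ge> N \<Longrightarrow> \<delta> < norm (?f (X n))"
      unfolding eventually_sequentially by blast
    \<comment> \<open>Otherwise \<open>resolution_norm_le\<close> would bound f(X (n + N)) by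
      \<open>\<delta>\<close> in norm.\<close>
    have "\<exists>l g. g \<in> projections \<and> g \<noteq> 0 \<and> X (n + N) * g = l *\<^sub>R g \<and> \<bar>?f l\<bar> > \<delta>" for n
    proof (rule ccontr)
      assume no: "\<nexists>l g. g \<in> projections \<and> g \<noteq> 0 \<and> X (n + N) * g = l *\<^sub>R g \<and> \<bar>?f l\<bar> > \<delta>"
      obtain L where L: "resolution L (\<lambda>l. l) (eigenprojection (X (n + N))) (X (n + N))"
        using X(1) unfolding resolved_def by blast
      have "norm (?f (X (n + N))) \<le> \<delta>"
      proof (rule resolution_norm_le[OF resolution_shift_product[OF L]])
        fix l assume "l \<in> L" "eigenprojection (X (n + N)) l \<noteq> 0"
        then show "\<bar>?f l\<bar> \<le> \<delta>"
          using no resolutionD(2)[OF L] resolution_mult_projection(1)[OF L] by force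
      qed (use \<open>\<delta> > 0\<close> in simp)
      then show False using N[of "n + N"] by simp
    qed
    then obtain l g where lg: "\<And>n. g n \<in> projections" "\<And>n. g n \<noteq> 0"
      "\<And>n. X (n + N) * g n = l n *\<^sub>R g n" "\<And>n. \<bar>?f (l n)\<bar> > \<delta>" by metis
    have ng: "norm (g n) = 1" for n using norm_projection lg by blast
    obtain B where B: "\<And>n. norm (X n) \<le> B"
      using convergent_imp_Bseq[OF convergentI[OF X(3)]] by (auto simp: Bseq_def)
    have "\<bar>l n\<bar> \<le> B" for n
    proof -
      have "\<bar>l n\<bar> = norm (X (n + N) * g n)" by (simp add: lg(3) ng)
      also have "\<dots> \<le> norm (X (n + N)) * norm (g n)" by (rule norm_mult_ineq)
      finally show ?thesis using B[of "n + N"] by (simp add: ng)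
    qed
    then have bl: "Bseq (\<lambda>n. l (r n))" for r :: "nat \<Rightarrow> nat" by (intro BseqI') auto
    obtain r where r: "strict_mono r" "monoseq (\<lambda>n. l (r n))" using seq_monosub by blast
    then obtain m where m: "(\<lambda>n. l (r n)) \<longlonglongrightarrow> m"
      using Bseq_monoseq_convergent[OF bl] by (auto simp: convergent_def)
    have "(\<lambda>n. \<bar>?f (l (r n))\<bar>) \<longlonglongrightarrow> \<bar>?f m\<bar>" by (intro tendsto_rabs tendsto_shift_product m)
    then have "\<delta> \<le> \<bar>?f m\<bar>" by (rule LIMSEQ_le_const) (use lg(4) less_imp_le in blast)
    then have "m \<notin> F" using \<open>\<delta> > 0\<close> shift_product_eq_0[of ls m] ls by auto
    then have "complex_of_real m *\<^sub>C 1 - x \<in> GL" by (simp add: F_def spectrum_def)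
    then obtain R where R: "R * (m *\<^sub>R 1 - x) = 1" by (auto simp: GL_def scaleC_of_real)
    \<comment> \<open>The element inside the norm fixes \<open>g (r n)\<close>, which has norm 1,
      and yet it tends to R 0 = 0.\<close>
    have "1 \<le> norm (R * (m *\<^sub>R 1 - x + (X (r n + N) - l (r n) *\<^sub>R 1)))" for n
    proof -
      have "R * (m *\<^sub>R 1 - x + (X (r n + N) - l (r n) *\<^sub>R 1)) * g (r n) = g (r n)"
        using lg(3) by (simp add: distrib_left distrib_right R mult.assoc left_diff_distrib)
      then have "1 \<le> norm (R * (m *\<^sub>R 1 - x + (X (r n + N) - l (r n) *\<^sub>R 1))) * norm (g (r n))"
        using norm_mult_ineq ng by metis
      then show ?thesis by (simp add: ng)
    qed
    moreover have "(\<lambda>n. norm (R * (m *\<^sub>R 1 - x + (X (r n + N) - l (r n) *\<^sub>R 1)))) \<longlonglongrightarrow>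
        norm (R * (m *\<^sub>R 1 - x + (x - m *\<^sub>R 1)))"
      using LIMSEQ_subseq_LIMSEQ[OF LIMSEQ_ignore_initial_segment[OF X(3), of N] r(1)] m
      by (intro tendsto_intros) (auto simp: o_def)
    ultimately have "1 \<le> norm (R * (m *\<^sub>R 1 - x + (x - m *\<^sub>R 1)))"
      by (intro LIMSEQ_le_const) auto
    then show False by simp
  qed
  then show ?thesis using shift_product_eq_0_resolved[OF sx ls(2)] by blast
qed

section \<open>The trace of self-adjoint elements\<close>

lemma dimension_functionD:
  assumes "dimension_function D"
  shows "p \<in> projections \<Longrightarrow> 0 \<le> D p" "p \<in> projections \<Longrightarrow> q \<in> projections \<Longrightarrow> mvn_equiv p q \<Longrightarrow> D p = D q"
    "p \<in> projections \<Longrightarrow> q \<in> projections \<Longrightarrow> p * q = 0 \<Longrightarrow> D (p + q) = D p + D q" "D 1 = 1"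
  using assms by (auto simp: dimension_function_def)

lemma dimension_zero: "dimension_function D \<Longrightarrow> D 0 = 0"
  using dimension_functionD(3)[of D 0 0] by (auto simp: projections_def)

lemma dimension_sum:
  assumes D: "dimension_function D" and "finite K" "\<And>i. i \<in> K \<Longrightarrow> p i \<in> projections"
    "\<And>i j. i \<in> K \<Longrightarrow> j \<in> K \<Longrightarrow> i \<noteq> j \<Longrightarrow> p i * p j = 0"
  shows "D (sum p K) = (\<Sum>i\<in>K. D (p i))"
  using assms(2-)
proof (induction K rule: finite_induct)
  case (insert k K)
  have "p k * sum p K = 0"
    unfolding sum_distrib_left by (rule sum.neutral) (use insert in auto)
  moreover have "sum p K \<in> projections" by (rule orthogonal_sum_projection) (use insert in auto)
  ultimately have "D (p k + sum p K) = D (p k) + D (sum p K)"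
    using insert by (intro dimension_functionD(3)[OF D]) auto
  then show ?case using insert by simp
qed (simp add: dimension_zero[OF D])

text \<open>Points of \<open>M\<close> that are not values contribute 0. This lets two resolutions
  of \<open>x\<close> be compared over the union of their values.\<close>

lemma resolution_trace_eigenprojections:
  assumes D: "dimension_function D" and r: "resolution I \<alpha> p x" and M: "\<alpha> ` I \<subseteq> M" "finite M"
  shows "(\<Sum>i\<in>I. \<alpha> i * D (p i)) = (\<Sum>l\<in>M. l * D (eigenprojection x l))"
proof -
  have "l * D (eigenprojection x l) = (\<Sum>i\<in>{i\<in>I. \<alpha> i = l}. \<alpha> i * D (p i))" for l
  proof -
    have "D (eigenprojection x l) = (\<Sum>i\<in>{i\<in>I. \<alpha> i = l}. D (p i))"
      unfolding resolution_eigenprojection(1)[OF r]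
      by (rule dimension_sum[OF D]) (use resolutionD[OF r] in auto)
    then show ?thesis by (simp add: sum_distrib_left)
  qed
  then have "(\<Sum>l\<in>M. l * D (eigenprojection x l))
      = (\<Sum>l\<in>M. \<Sum>i\<in>{i\<in>I. \<alpha> i = l}. \<alpha> i * D (p i))"
    by (rule sum.cong[OF refl])
  also have "\<dots> = (\<Sum>i\<in>I. \<alpha> i * D (p i))" by (rule sum.group[OF resolutionD(1)[OF r] M(2,1)])
  finally show ?thesis ..
qed

lemma resolution_trace_unique:
  assumes D: "dimension_function D" and r: "resolution I \<alpha> p x" "resolution J \<beta> q x"
  shows "(\<Sum>i\<in>I. \<alpha> i * D (p i)) = (\<Sum>j\<in>J. \<beta> j * D (q j))"
proof -
  have "finite (\<alpha> ` I \<union> \<beta> ` J)" using resolutionD(1)[OF r(1)] resolutionD(1)[OF r(2)] by simp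
  then show ?thesis
    using resolution_trace_eigenprojections[OF D r(1)] resolution_trace_eigenprojections[OF D r(2)]
    by (metis Un_upper1 Un_upper2)
qed

text \<open>The families in \<open>simple_trace\<close> need not add up to 1. Their complement is
  adjoined at the free index 0 with coefficient 0, which changes neither the element nor its
  trace.\<close>

lemma orthogonal_family_resolution:
  fixes p :: "nat \<Rightarrow> 'a::cstar_algebra"
  assumes p: "\<And>k. k \<in> {1..n} \<Longrightarrow> p k \<in> projections"
    "\<And>j k. j \<in> {1..n} \<Longrightarrow> k \<in> {1..n} \<Longrightarrow> j \<noteq> k \<Longrightarrow> p j * p k = 0"
  shows "resolution (insert 0 {1..n}) (\<alpha>(0 := 0)) (p(0 := 1 - (\<Sum>k=1..n. p k))) (\<Sum>k=1..n. \<alpha> k *\<^sub>R p k)"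
proof -
  define g where "g = (\<Sum>k=1..n. p k)"
  have "g \<in> projections" unfolding g_def by (rule orthogonal_sum_projection) (use p in auto)
  note g = projectionsD[OF this]
  have pg: "p k * g = p k" if "k \<in> {1..n}" for k
  proof -
    have "p k * g = (\<Sum>j=1..n. if j = k then p k else 0)"
      unfolding g_def sum_distrib_left
      by (rule sum.cong[OF refl]) (use p that in \<open>auto simp: projectionsD\<close>)
    then show ?thesis using that by simp
  qed
  have gp: "g * p k = p k" if "k \<in> {1..n}" for k
    using pg[OF that] projectionsD(1)[OF p(1)[OF that]] g(1) by (metis star_mult)
  let ?p = "p(0 := 1 - g)"
  have sums: "sum ?p {1..n} = g" "(\<Sum>k=1..n. (\<alpha>(0 := 0)) k *\<^sub>R ?p k) = (\<Sum>k=1..n. \<alpha> k *\<^sub>R p k)"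
    unfolding g_def by (auto intro!: sum.cong)
  have "1 - g \<in> projections" using g by (intro projectionsI) (auto simp: star_diff algebra_simps)
  then have "resolution (insert 0 {1..n}) (\<alpha>(0 := 0)) ?p (\<Sum>k=1..n. \<alpha> k *\<^sub>R p k)"
    unfolding resolution_def using p pg gp sums by (auto simp: algebra_simps)
  then show ?thesis by (simp only: g_def)
qed

lemma simple_trace_eq:
  assumes D: "dimension_function D" and r: "resolution I \<alpha> p x"
  shows "simple_trace D x = (\<Sum>i\<in>I. \<alpha> i * D (p i))"
  unfolding simple_trace_def
proof (rule the_equality)
  obtain h where h: "bij_betw h {1..card I} I"
    using ex_bij_betw_nat_finite_1[OF resolutionD(1)[OF r]] by blast
  have "x = (\<Sum>k=1..card I. \<alpha> (h k) *\<^sub>R p (h k))"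
    unfolding resolutionD(6)[OF r] by (rule sum.reindex_bij_betw[OF h, symmetric])
  moreover have "(\<Sum>i\<in>I. \<alpha> i * D (p i)) = (\<Sum>k=1..card I. \<alpha> (h k) * D (p (h k)))"
    by (rule sum.reindex_bij_betw[OF h, symmetric])
  moreover have "h k \<in> I" if "k \<in> {1..card I}" for k using bij_betwE[OF h] that by blast
  moreover have "h j \<noteq> h k" if "j \<in> {1..card I}" "k \<in> {1..card I}" "j \<noteq> k" for j k
    using bij_betw_imp_inj_on[OF h] that by (metis inj_onD)
  ultimately show "\<exists>(n::nat) \<alpha>' p'.
    (\<forall>k\<in>{1..n}. p' k \<in> projections) \<and>
    (\<forall>j\<in>{1..n}. \<forall>k\<in>{1..n}. j \<noteq> k \<longrightarrow> p' j * p' k = 0) \<and>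
    x = (\<Sum>k=1..n. \<alpha>' k *\<^sub>R p' k) \<and>
    (\<Sum>i\<in>I. \<alpha> i * D (p i)) = (\<Sum>k=1..n. \<alpha>' k * D (p' k))"
    using resolutionD(2,4)[OF r]
    by (intro exI[of _ "card I"] exI[of _ "\<lambda>k. \<alpha> (h k)"] exI[of _ "\<lambda>k. p (h k)"]) blast
next
  fix t
  assume "\<exists>(n::nat) \<alpha>' p'.
    (\<forall>k\<in>{1..n}. p' k \<in> projections) \<and>
    (\<forall>j\<in>{1..n}. \<forall>k\<in>{1..n}. j \<noteq> k \<longrightarrow> p' j * p' k = 0) \<and>
    x = (\<Sum>k=1..n. \<alpha>' k *\<^sub>R p' k) \<and> t = (\<Sum>k=1..n. \<alpha>' k * D (p' k))"
  then obtain n :: nat and \<beta> q where q: "\<And>k. k \<in> {1..n} \<Longrightarrow> q k \<in> projections"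
    "\<And>j k. j \<in> {1..n} \<Longrightarrow> k \<in> {1..n} \<Longrightarrow> j \<noteq> k \<Longrightarrow> q j * q k = 0"
    "x = (\<Sum>k=1..n. \<beta> k *\<^sub>R q k)" "t = (\<Sum>k=1..n. \<beta> k * D (q k))" by blast
  have "resolution (insert 0 {1..n}) (\<beta>(0 := 0)) (q(0 := 1 - (\<Sum>k=1..n. q k))) x"
    unfolding q(3) by (rule orthogonal_family_resolution) (fact q(1), fact q(2))
  from resolution_trace_unique[OF D r this]
  have "(\<Sum>i\<in>I. \<alpha> i * D (p i))
    = (\<Sum>k\<in>insert 0 {1..n}. (\<beta>(0 := 0)) k * D ((q(0 := 1 - (\<Sum>k=1..n. q k))) k))" .
  also have "\<dots> = (\<Sum>k=1..n. (\<beta>(0 := 0)) k * D ((q(0 := 1 - (\<Sum>k=1..n. q k))) k))" by simp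
  also have "\<dots> = t" unfolding q(4) by (rule sum.cong) auto
  finally show "t = (\<Sum>i\<in>I. \<alpha> i * D (p i))" ..
qed

lemma simple_trace_add:
  assumes D: "dimension_function D" and "resolved x" "resolved y" "x * y = y * x"
  shows "simple_trace D (x + y) = simple_trace D x + simple_trace D y"
proof -
  obtain I :: "(real \<times> real) set" and \<alpha> \<beta> p where r: "resolution I \<alpha> p x" "resolution I \<beta> p y"
    using resolved_common_resolution[OF assms(2-)] .
  show ?thesis
    by (simp add: simple_trace_eq[OF D r(1)] simple_trace_eq[OF D r(2)]
        simple_trace_eq[OF D resolution_add[OF r]] distrib_right sum.distrib)
qed

text \<open>Over a common resolution the coefficients differ by at most \<open>norm (x - y)\<close>
  wherever \<open>p i\<close> is nonzero, and the weights \<open>D (p i)\<close> add up to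
  1.\<close>

lemma simple_trace_dist_le:
  assumes D: "dimension_function D" and "resolved x" "resolved y" "x * y = y * x"
  shows "\<bar>simple_trace D x - simple_trace D y\<bar> \<le> norm (x - y)"
proof -
  obtain I :: "(real \<times> real) set" and \<alpha> \<beta> p where r: "resolution I \<alpha> p x" "resolution I \<beta> p y"
    using resolved_common_resolution[OF assms(2-)] .
  note rd = resolutionD[OF r(1)]
  have le: "\<bar>(\<alpha> i - \<beta> i) * D (p i)\<bar> \<le> norm (x - y) * D (p i)" if "i \<in> I" for i
  proof (cases "p i = 0")
    case True
    then show ?thesis by (simp add: dimension_zero[OF D])
  next
    case False
    then have n: "norm (p i) = 1" using norm_projection rd(2) that by blast
    have "(x - y) * p i = (\<alpha> i - \<beta> i) *\<^sub>R p i"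
      using resolution_mult_projection(1)[OF r(1) that] resolution_mult_projection(1)[OF r(2) that]
      by (simp add: algebra_simps)
    then have "\<bar>\<alpha> i - \<beta> i\<bar> = norm ((x - y) * p i)" by (simp add: n)
    also have "\<dots> \<le> norm (x - y)" using norm_mult_ineq[of "x - y" "p i"] by (simp add: n)
    finally show ?thesis
      using dimension_functionD(1)[OF D rd(2)[OF that]] by (simp add: abs_mult mult_right_mono)
  qed
  have "(\<Sum>i\<in>I. D (p i)) = 1"
    using dimension_sum[OF D rd(1), of p] rd dimension_functionD(4)[OF D] by simp
  moreover have "simple_trace D x - simple_trace D y = (\<Sum>i\<in>I. (\<alpha> i - \<beta> i) * D (p i))"
    by (simp add: simple_trace_eq[OF D r(1)] simple_trace_eq[OF D r(2)] left_diff_distrib sum_subtractf)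
  moreover have "\<bar>\<Sum>i\<in>I. (\<alpha> i - \<beta> i) * D (p i)\<bar> \<le> (\<Sum>i\<in>I. norm (x - y) * D (p i))"
    by (rule order_trans[OF sum_abs sum_mono]) (use le in auto)
  ultimately show ?thesis by (simp flip: sum_distrib_left)
qed

section \<open>The trace of self-adjoint elements as a limit\<close>

text \<open>The approximants are only asked to commute with \<open>a\<close>, a weaker condition
  than in \<open>simple_approximation\<close> and one that the sums and conjugates below satisfy.
  The reference sequence \<open>X\<close> lies in the bicommutant, hence commutes with
  \<open>Y\<close>, so the Lipschitz estimate compares the two.\<close>

lemma selfadjoint_trace_limit:
  assumes D: "dimension_function D" and a: "star a = a"
    and Y: "\<And>n. resolved (Y n)" "\<And>n. Y n * a = a * Y n" "Y \<longlonglongrightarrow> a"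
  shows "(\<lambda>n. simple_trace D (Y n)) \<longlonglongrightarrow> selfadjoint_trace D a"
proof -
  obtain X where X: "\<And>n. resolved (X n)" "\<And>n. X n \<in> bicommutant a" "X \<longlonglongrightarrow> a"
    using resolved_sequence[OF a] by blast
  have "Cauchy (\<lambda>n. simple_trace D (X n))"
    unfolding Cauchy_def
  proof (intro allI impI)
    fix \<epsilon> :: real assume "\<epsilon> > 0"
    then obtain M where "\<And>m n. m \<ge> M \<Longrightarrow> n \<ge> M \<Longrightarrow> dist (X m) (X n) < \<epsilon>"
      using LIMSEQ_imp_Cauchy[OF X(3)] unfolding Cauchy_def by blast
    then show "\<exists>M. \<forall>m\<ge>M. \<forall>n\<ge>M. dist (simple_trace D (X m)) (simple_trace D (X n)) < \<epsilon>"
      using simple_trace_dist_le[OF D X(1) X(1) bicommutant_commute[OF X(2) X(2)]]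
      unfolding dist_norm real_norm_def by (meson le_less_trans)
  qed
  then obtain L where L: "(\<lambda>n. simple_trace D (X n)) \<longlonglongrightarrow> L"
    using Cauchy_convergent_iff by (auto simp: convergent_def)
  have lim: "(\<lambda>n. simple_trace D (Z n)) \<longlonglongrightarrow> L"
    if Z: "\<And>n. resolved (Z n)" "\<And>n. Z n * a = a * Z n" "Z \<longlonglongrightarrow> a" for Z
  proof -
    have "(\<lambda>n. Z n - X n) \<longlonglongrightarrow> a - a" by (intro tendsto_diff Z X)
    then have "(\<lambda>n. Z n - X n) \<longlonglongrightarrow> 0" by simp
    then have "(\<lambda>n. simple_trace D (Z n) - simple_trace D (X n)) \<longlonglongrightarrow> 0"
      by (rule tendsto_0_le[where K = 1])
        (use simple_trace_dist_le[OF D Z(1) X(1) bicommutantD[OF X(2) Z(2)]] in auto)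
    from tendsto_add[OF this L] show ?thesis by simp
  qed
  have "selfadjoint_trace D a = L"
    unfolding selfadjoint_trace_def
  proof (rule the_equality)
    show "\<forall>X. simple_approximation a X \<longrightarrow> (\<lambda>n. simple_trace D (X n)) \<longlonglongrightarrow> L"
    proof (intro allI impI)
      fix Z assume Z: "simple_approximation a Z"
      then have "a * Z n = Z n * a" for n
        by (auto simp: simple_approximation_def intro: bicommutantD)
      with Z show "(\<lambda>n. simple_trace D (Z n)) \<longlonglongrightarrow> L"
        by (intro lim) (auto simp: simple_approximation_def intro: finite_spectrum_resolved)
    qed
    have "simple_approximation a X"
      unfolding simple_approximation_def
      using X resolved_finite_spectrum resolved_selfadjoint by blast
    then show "l = L" if "\<forall>X. simple_approximation a X \<longrightarrow> (\<lambda>n. simple_trace D (X n)) \<longlonglongrightarrow> l" for l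
      using that L LIMSEQ_unique by blast
  qed
  with lim[OF Y] show ?thesis by simp
qed

text \<open>Approximants from the bicommutants of \<open>a\<close> and of \<open>b\<close> commute
  with each other, and their sums commute with \<open>a + b\<close>, as
  \<open>selfadjoint_trace_limit\<close> requires.\<close>

lemma selfadjoint_trace_add:
  assumes D: "dimension_function D" and a: "star a = a" and b: "star b = b" and c: "a * b = b * a"
  shows "selfadjoint_trace D (a + b) = selfadjoint_trace D a + selfadjoint_trace D b"
proof -
  obtain X where X: "\<And>n. resolved (X n)" "\<And>n. X n \<in> bicommutant a" "X \<longlonglongrightarrow> a"
    using resolved_sequence[OF a] by blast
  obtain Y where Y: "\<And>n. resolved (Y n)" "\<And>n. Y n \<in> bicommutant b" "Y \<longlonglongrightarrow> b"
    using resolved_sequence[OF b] by blast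
  have Xa: "X n * a = a * X n" for n using bicommutantD[OF X(2), of a] by simp
  have Yb: "Y n * b = b * Y n" for n using bicommutantD[OF Y(2), of b] by simp
  have Xb: "X n * b = b * X n" for n using bicommutantD[OF X(2), of b] c by simp
  have Ya: "Y n * a = a * Y n" for n using bicommutantD[OF Y(2), of a] c by simp
  have XY: "X n * Y n = Y n * X n" for n using bicommutantD[OF X(2) Ya] by simp
  have "(\<lambda>n. simple_trace D (X n + Y n)) \<longlonglongrightarrow> selfadjoint_trace D (a + b)"
    by (rule selfadjoint_trace_limit[OF D])
      (auto intro!: resolved_add X Y XY tendsto_add simp: star_add a b algebra_simps Xa Xb Ya Yb)
  moreover have "(\<lambda>n. simple_trace D (X n + Y n)) \<longlonglongrightarrow> selfadjoint_trace D a + selfadjoint_trace D b"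
    unfolding simple_trace_add[OF D X(1) Y(1) XY]
    by (intro tendsto_add selfadjoint_trace_limit[OF D] X Y a b Xa Yb)
  ultimately show ?thesis by (rule LIMSEQ_unique)
qed

lemma selfadjoint_trace_scaleR_projection:
  assumes D: "dimension_function D" and g: "g \<in> projections"
  shows "selfadjoint_trace D (t *\<^sub>R g) = t * D g"
proof -
  have r: "resolution UNIV (\<lambda>b. if b then t else 0) (\<lambda>b. if b then g else 1 - g) (t *\<^sub>R g)"
    using resolution_symmetry[OF g, of t 0] by simp
  have "(\<lambda>n. simple_trace D (t *\<^sub>R g)) \<longlonglongrightarrow> selfadjoint_trace D (t *\<^sub>R g)"
    by (rule selfadjoint_trace_limit[OF D])
      (use resolvedI[OF r] resolution_selfadjoint[OF r] in auto)
  then have "selfadjoint_trace D (t *\<^sub>R g) = simple_trace D (t *\<^sub>R g)"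
    by (simp add: LIMSEQ_const_iff)
  then show ?thesis by (simp add: simple_trace_eq[OF D r] UNIV_bool)
qed

text \<open>Unitary conjugation preserves \<open>D\<close>, so the negatives of the conjugated
  approximants have the negated traces. They converge to \<open>a\<close> again, and the trace of
  \<open>a\<close> equals its own negative.\<close>

lemma selfadjoint_trace_eq_0:
  assumes D: "dimension_function D" and a: "star a = a"
    and W: "star W * W = 1" "W * star W = 1" "W * a * star W = - a"
  shows "selfadjoint_trace D a = 0"
proof -
  obtain X where X: "\<And>n. resolved (X n)" "\<And>n. X n \<in> bicommutant a" "X \<longlonglongrightarrow> a"
    using resolved_sequence[OF a] by blast
  have WW: "star W * (W * z) = z" for z using W(1) by (metis mult.assoc mult.left_neutral)
  define Y where "Y n = - (W * X n * star W)" for n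
  have Y: "resolved (Y n) \<and> simple_trace D (Y n) = - simple_trace D (X n)" for n
  proof -
    obtain L where r: "resolution L (\<lambda>l. l) (eigenprojection (X n)) (X n)"
      using X(1) by (auto simp: resolved_def)
    let ?e = "eigenprojection (X n)"
    note rd = resolutionD[OF r]
    have mult: "(W * x * star W) * (W * y * star W) = W * (x * y) * star W" for x y
      by (simp add: mult.assoc WW)
    have proj: "W * ?e l * star W \<in> projections" if "l \<in> L" for l
      using rd(2,3)[OF that] by (intro projectionsI) (simp_all only: mult, simp add: star_mult star_star projectionsD mult.assoc)
    have s: "resolution L (\<lambda>l. - l) (\<lambda>l. W * ?e l * star W) (Y n)"
      unfolding resolution_def
    proof (intro conjI ballI impI)
      show "(\<Sum>l\<in>L. W * ?e l * star W) = 1"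
        using rd(5) W(2) by (simp flip: sum_distrib_left sum_distrib_right)
      have "Y n = - (W * (\<Sum>l\<in>L. l *\<^sub>R ?e l) * star W)" unfolding Y_def by (simp flip: rd(6))
      then show "Y n = (\<Sum>l\<in>L. (- l) *\<^sub>R (W * ?e l * star W))"
        by (simp add: sum_distrib_left sum_distrib_right sum_negf)
    qed (use rd proj in \<open>simp_all add: mult\<close>)
    have "D (W * ?e l * star W) = D (?e l)" if "l \<in> L" for l
    proof (rule dimension_functionD(2)[OF D proj[OF that] rd(2)[OF that], symmetric, THEN sym])
      show "mvn_equiv (W * ?e l * star W) (?e l)"
        unfolding mvn_equiv_def using projectionsD[OF rd(2)[OF that]]
        by (intro exI[of _ "?e l * star W"]) (simp add: star_mult star_star mult.assoc WW, metis mult.assoc)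
    qed
    then show ?thesis
      using resolvedI[OF s] by (simp add: simple_trace_eq[OF D s] simple_trace_eq[OF D r] sum_negf)
  qed
  have "Y \<longlonglongrightarrow> - (W * a * star W)" unfolding Y_def by (intro tendsto_intros X)
  then have Ya: "Y \<longlonglongrightarrow> a" by (simp add: W(3))
  have "Y n * a = a * Y n" for n
  proof -
    have "X n * a = a * X n" using bicommutantD[OF X(2), of a] by simp
    moreover have "a = - (W * a * star W)" by (simp add: W(3))
    moreover have "(W * X n * star W) * (W * a * star W) = W * (X n * a) * star W"
      "(W * a * star W) * (W * X n * star W) = W * (a * X n) * star W" by (simp_all add: mult.assoc WW)
    ultimately show ?thesis unfolding Y_def by (metis minus_mult_minus)
  qed
  then have "(\<lambda>n. simple_trace D (Y n)) \<longlonglongrightarrow> selfadjoint_trace D a"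
    using Y Ya by (intro selfadjoint_trace_limit[OF D a]) auto
  moreover have "(\<lambda>n. simple_trace D (Y n)) \<longlonglongrightarrow> - selfadjoint_trace D a"
    using Y by (auto intro!: tendsto_minus selfadjoint_trace_limit[OF D a] X bicommutantD[OF X(2), of a, symmetric])
  ultimately have "selfadjoint_trace D a = - selfadjoint_trace D a" by (rule LIMSEQ_unique)
  then show ?thesis by simp
qed

section \<open>Idempotents\<close>

text \<open>The relation \<open>anti\<close> says that \<open>c\<close> has no diagonal blocks
  relative to \<open>p\<close> and \<open>1 - p\<close>. Additivity is available for commuting
  summands only, so \<open>p + c\<close> is regrouped along the support of \<open>c\<close>.\<close>

lemma off_diagonal_trace:
  fixes p c :: "'a::aw_star_factor_II1"
  assumes D: "dimension_function D" and p: "p \<in> projections" and c: "star c = c"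
    and J: "J = 2 *\<^sub>R p - 1" and anti: "J * c = - (c * J)"
  shows "selfadjoint_trace D (p + c) = D p"
proof -
  note pp = projectionsD[OF p]
  have sJ: "star J = J" by (simp add: J star_diff star_scaleR pp)
  have JJ: "J * J = 1" by (simp add: J algebra_simps pp scaleR_2)
  have JJ': "J * (J * z) = z" for z using JJ by (metis mult.assoc mult.left_neutral)
  obtain h g1 g2 where pos: "positive h" and h: "h \<in> bicommutant (c * c)" "support_projection (h + c) g1"
    "support_projection (h - c) g2" "g1 * g2 = 0" "g2 * g1 = 0"
    "2 *\<^sub>R (h * g1) = h + c" "h * g1 = c * g1" "h * g2 = - (c * g2)"
    using absolute_value[OF c] by metis
  note g1 = support_projectionD[OF h(2)] and g2 = support_projectionD[OF h(3)]
  \<comment> \<open>The two signs cancel in c^2, so \<open>J\<close> commutes with it and with its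
    root.\<close>
  have Jh: "J * h = h * J"
    by (rule bicommutantD[OF h(1)]) (metis anti minus_mult_minus mult.assoc mult_minus_left mult_minus_right)
  \<comment> \<open>Conjugation by \<open>J\<close> exchanges the positive and negative parts of
    \<open>c\<close>, hence also their supports.\<close>
  have "J * (h + c) = (h - c) * J" by (simp add: algebra_simps Jh anti)
  then have "J * (h + c) * J = h - c" by (simp add: mult.assoc JJ)
  then have "J * g1 * J = g2"
    using support_projection_unique support_projection_conjugate[OF h(2) sJ JJ] h(3) by metis
  then have Jg: "g2 * J = J * g1" "J * g2 = g1 * J"
    using JJ JJ' by (auto simp: mult.assoc)
  \<comment> \<open>\<open>r\<close> is the support of \<open>c\<close> and \<open>\<sigma>\<close>
    its sign; \<open>J\<close> commutes with \<open>r\<close> and anticommutes with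
    \<open>\<sigma>\<close>.\<close>
  define r where "r = g1 + g2"
  define \<sigma> where "\<sigma> = g1 - g2"
  have r: "star r = r" "r * r = r" "r \<in> projections"
    using g1 g2 h(4,5) by (auto simp: r_def star_add algebra_simps intro!: projectionsI)
  have \<sigma>: "star \<sigma> = \<sigma>" "\<sigma> * \<sigma> = r" "r * \<sigma> = \<sigma>" "\<sigma> * r = \<sigma>"
    using g1 g2 h(4,5) by (auto simp: r_def \<sigma>_def star_diff algebra_simps)
  have Jr: "J * r = r * J" and J\<sigma>: "J * \<sigma> = - (\<sigma> * J)"
    using Jg by (auto simp: r_def \<sigma>_def algebra_simps)
  have "(h - c) * g2 = h - c" by (rule g2(4))
  then have hg2: "2 *\<^sub>R (h * g2) = h - c" using h(8) by (simp add: algebra_simps scaleR_2)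
  have "2 *\<^sub>R (c * \<sigma>) = 2 *\<^sub>R (h * g1) + 2 *\<^sub>R (h * g2)"
    using h(7,8) by (simp add: \<sigma>_def algebra_simps)
  then have c\<sigma>: "c * \<sigma> = h" unfolding h(6) hg2 by (simp flip: scaleR_2)
  have "2 *\<^sub>R (c * r) = 2 *\<^sub>R (h * g1) - 2 *\<^sub>R (h * g2)"
    using h(7,8) by (simp add: r_def algebra_simps)
  then have cr: "c * r = c" unfolding h(6) hg2 by (simp flip: scaleR_2)
  have rc: "r * c = c" using cr c r(1) by (metis star_mult)
  have "star (c * \<sigma>) = h" by (simp add: c\<sigma> positive_selfadjoint[OF pos])
  then have \<sigma>c: "\<sigma> * c = h" by (simp add: star_mult \<sigma> c)
  \<comment> \<open>On the support \<open>r\<close> of \<open>c\<close> the unitary \<open>J \<sigma>\<close> anticommutes with both \<open>J\<close> and \<open>c\<close>,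
    so it turns the \<open>r\<close>-part \<open>m\<close> of \<open>p - 1/2 + c\<close> into its negative.\<close>
  define W where "W = J * \<sigma> + (1 - r)"
  define m where "m = (1 / 2) *\<^sub>R (J * r) + c"
  have sW: "star W = - (J * \<sigma>) + (1 - r)"
    by (simp add: W_def star_add star_diff star_mult sJ \<sigma> r J\<sigma>)
  have J\<sigma>J\<sigma>: "J * \<sigma> * (J * \<sigma>) = - r"
    by (metis J\<sigma> JJ' \<sigma>(2) mult.assoc mult_minus_left mult_minus_right)
  have J\<sigma>r: "J * \<sigma> * r = J * \<sigma>" "r * (J * \<sigma>) = J * \<sigma>"
    by (metis \<sigma>(4) mult.assoc, metis Jr \<sigma>(3) mult.assoc)
  have W: "star W * W = 1" "W * star W = 1"
    unfolding sW by (simp_all add: W_def algebra_simps J\<sigma>J\<sigma>[unfolded mult.assoc] J\<sigma>r[unfolded mult.assoc] r)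
  have rm: "r * m = m" "m * r = m"
    by (simp_all add: m_def distrib_left distrib_right rc cr mult.assoc r(2))
      (simp add: Jr r(2) flip: mult.assoc)
  have "W * m = - (m * W)"
  proof -
    have a: "J * \<sigma> * (J * r) = - \<sigma>" "J * r * (J * \<sigma>) = \<sigma>"
      by (metis J\<sigma> JJ' \<sigma>(4) mult.assoc mult_minus_left mult_minus_right,
          metis Jr JJ' \<sigma>(3) mult.assoc)
    have b: "J * \<sigma> * c = J * h" "c * (J * \<sigma>) = - (J * h)"
      by (simp add: mult.assoc \<sigma>c, metis anti c\<sigma> mult.assoc mult_minus_left minus_minus)
    have "J * \<sigma> * m = - (m * (J * \<sigma>))"
      by (simp add: m_def distrib_left distrib_right a b)
    moreover have "(1 - r) * m = 0" "m * (1 - r) = 0" by (simp_all add: algebra_simps rm)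
    ultimately show ?thesis by (simp add: W_def distrib_left distrib_right)
  qed
  then have "W * m * star W = - m" using W(2) by (metis mult.assoc mult_minus_left mult.right_neutral)
  moreover have sm: "star m = m" by (simp add: m_def star_add star_scaleR star_mult sJ r c Jr)
  ultimately have tm: "selfadjoint_trace D m = 0" using selfadjoint_trace_eq_0[OF D _ W] by blast
  have "2 *\<^sub>R (p * r) = 2 *\<^sub>R (r * p)" using Jr by (simp add: J algebra_simps)
  then have pr: "p * r = r * p" by simp
  have J_half: "(1 / 2) *\<^sub>R (J * r) = p * r - (1 / 2) *\<^sub>R r" by (simp add: J algebra_simps)
  have prpr: "p * r * (p * r) = p * r" by (metis pr pp(2) r(2) mult.assoc)
  have ppr: "p * (p * r) = p * r" "p * r * p = p * r" "p * r * r = p * r" "r * (p * r) = p * r"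
    by (metis pp(2) mult.assoc, metis pr pp(2) mult.assoc, metis r(2) mult.assoc,
        metis pr r(2) mult.assoc)
  have spr: "star (p * r) = p * r" by (simp add: star_mult pp r pr)
  have P: "p - p * r \<in> projections" "p * r \<in> projections" "r - p * r \<in> projections"
    using pp r(1,2) prpr ppr spr
    by (auto intro!: projectionsI simp: star_diff left_diff_distrib right_diff_distrib simp flip: pr)
  \<comment> \<open>Because \<open>\<sigma>\<close> anticommutes with \<open>J\<close>, it exchanges
    \<open>p\<close> and \<open>1 - p\<close> under \<open>r\<close>; thus
    \<open>\<sigma> * p\<close> is a partial isometry from \<open>p * r\<close> to
    \<open>r - p * r\<close>.\<close>
  have "D (p * r) = D (r - p * r)"
  proof (rule dimension_functionD(2)[OF D P(2,3)])
    have "2 *\<^sub>R (\<sigma> * p * \<sigma>) = r - J * r"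
    proof -
      have "\<sigma> * J * \<sigma> = - (J * r)" using J\<sigma> \<sigma>(2) by (metis mult.assoc mult_minus_left minus_minus)
      then show ?thesis using \<sigma>(2) unfolding J
        by (simp add: left_diff_distrib right_diff_distrib algebra_simps)
    qed
    also have "\<dots> = 2 *\<^sub>R (r - p * r)" by (simp add: J algebra_simps scaleR_2)
    finally have "\<sigma> * p * \<sigma> = r - p * r" by simp
    moreover have "p * \<sigma> * (\<sigma> * p) = p * r" by (metis \<sigma>(2) ppr(2) mult.assoc)
    ultimately show "mvn_equiv (p * r) (r - p * r)"
      unfolding mvn_equiv_def
      by (intro exI[of _ "\<sigma> * p"]) (simp add: star_mult \<sigma>(1) pp(1), metis pp(2) mult.assoc)
  qed
  moreover have "D (p - p * r + p * r) = D (p - p * r) + D (p * r)"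
    by (rule dimension_functionD(3)[OF D P(1,2)]) (simp add: left_diff_distrib ppr prpr)
  moreover have "D (p * r + (r - p * r)) = D (p * r) + D (r - p * r)"
    by (rule dimension_functionD(3)[OF D P(2,3)]) (simp add: right_diff_distrib ppr prpr)
  ultimately have Dp: "D p = D (p - p * r) + (1 / 2) * D r" by simp
  \<comment> \<open>As Jr/2 = pr - r/2, the terms recombine to \<open>p + c\<close>. The element
    \<open>m\<close> has \<open>r\<close> as a unit and is annihilated by \<open>p - p * r\<close>,
    so all summands commute.\<close>
  have eq: "p + c = ((p - p * r) + (1 / 2) *\<^sub>R r) + m" by (simp add: m_def J_half)
  have "selfadjoint_trace D (((p - p * r) + (1 / 2) *\<^sub>R r) + m)
      = selfadjoint_trace D ((p - p * r) + (1 / 2) *\<^sub>R r) + selfadjoint_trace D m"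
  proof (rule selfadjoint_trace_add[OF D _ sm])
    show "star (p - p * r + (1 / 2) *\<^sub>R r) = p - p * r + (1 / 2) *\<^sub>R r"
      by (simp add: star_add star_diff star_scaleR spr pp r)
    have "m * p * r = m * p" "p * r * m = p * m" by (metis pr rm(2) mult.assoc, metis rm(1) mult.assoc)
    then have "(p - p * r) * m = 0" "m * (p - p * r) = 0"
      by (simp_all add: left_diff_distrib right_diff_distrib mult.assoc)
    then show "(p - p * r + (1 / 2) *\<^sub>R r) * m = m * (p - p * r + (1 / 2) *\<^sub>R r)"
      by (simp add: distrib_left distrib_right rm)
  qed
  moreover have "selfadjoint_trace D ((p - p * r) + (1 / 2) *\<^sub>R r)
      = selfadjoint_trace D (p - p * r) + selfadjoint_trace D ((1 / 2) *\<^sub>R r)"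
    by (rule selfadjoint_trace_add[OF D])
      (simp_all add: star_diff star_scaleR spr pp r left_diff_distrib right_diff_distrib ppr flip: pr)
  ultimately show ?thesis
    unfolding eq using selfadjoint_trace_scaleR_projection[OF D P(1), of 1]
      selfadjoint_trace_scaleR_projection[OF D r(3), of "1 / 2"] tm Dp by simp
qed

text \<open>The assumptions make \<open>e\<close> block upper triangular: x = e - p satisfies px = x
  and xp = 0. Hence \<open>x + star x\<close> and \<open>x - star x\<close> both anticommute with J
  = 2p - 1.\<close>

lemma idempotent_trace:
  fixes e p :: "'a::aw_star_factor_II1"
  assumes D: "dimension_function D" and p: "p \<in> projections" and pe: "p * e = e" "e * p = p"
  shows "selfadjoint_trace D (re_part e) = D p" and "selfadjoint_trace D (im_part e) = 0"
proof -
  note pp = projectionsD[OF p]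
  define J where "J = 2 *\<^sub>R p - 1"
  have sJ: "star J = J" by (simp add: J_def star_diff star_scaleR pp)
  have JJ: "J * J = 1" by (simp add: J_def algebra_simps pp scaleR_2)
  define x where "x = e - p"
  have e: "e = p + x" by (simp add: x_def)
  have x: "p * x = x" "x * p = 0" by (simp_all add: x_def algebra_simps pe pp)
  have "star (p * x) = star x" "star (x * p) = 0" by (simp_all add: x)
  then have sx: "star x * p = star x" "p * star x = 0" by (simp_all add: star_mult pp)
  have J: "J * x = x" "x * J = - x" "J * star x = - star x" "star x * J = star x"
    by (simp_all add: J_def left_diff_distrib right_diff_distrib
        distrib_left distrib_right x sx scaleR_2)
  define c where "c = (1 / 2) *\<^sub>R (x + star x)"
  have "re_part e = (1 / 2) *\<^sub>R (e + star e)"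
    using scaleC_of_real[of "1 / 2" "e + star e"] by (simp add: re_part_def)
  also have "\<dots> = (1 / 2) *\<^sub>R (p + p) + c"
    by (simp only: e star_add pp c_def flip: scaleR_add_right) (simp add: algebra_simps)
  finally have "re_part e = p + c" by (simp flip: scaleR_2)
  moreover have "selfadjoint_trace D (p + c) = D p"
    by (rule off_diagonal_trace[OF D p _ J_def])
      (simp_all add: c_def star_scaleR star_add star_star add.commute distrib_left distrib_right J
        flip: scaleR_minus_right)
  ultimately show "selfadjoint_trace D (re_part e) = D p" by simp
  have im: "im_part e = (1 / (2 * \<i>)) *\<^sub>C (x - star x)"
    by (simp add: im_part_def e star_add pp)
  show "selfadjoint_trace D (im_part e) = 0"
  proof (rule selfadjoint_trace_eq_0[OF D])
    show "star (im_part e) = im_part e"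
      by (simp add: im star_scaleC star_diff star_star scaleC_minus_left flip: scaleC_minus_right)
    show "star J * J = 1" "J * star J = 1" by (simp_all add: sJ JJ)
    show "J * im_part e * star J = - im_part e"
      by (simp add: im sJ mult_scaleC_left mult_scaleC_right distrib_left distrib_right
          left_diff_distrib right_diff_distrib J flip: scaleC_minus_right)
  qed
qed

section \<open>Range projections of similar idempotents\<close>

text \<open>The range of \<open>e\<close> is the kernel of \<open>1 - e\<close>.\<close>

lemma idempotent_range_projection:
  fixes e :: "'a::aw_star_algebra"
  assumes "e * e = e"
  obtains p where "p \<in> projections" "p * e = e" "e * p = p"
proof -
  obtain p where p: "kernel_projection (1 - e) p" by (rule kernel_projection_exists)
  note pp = kernel_projectionD[OF p]
  have "p * e = e" using assms by (simp flip: pp(5) add: left_diff_distrib)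
  moreover have "e * p = p" using pp(4) by (simp add: left_diff_distrib)
  ultimately show ?thesis using that pp(1) by blast
qed

lemma similar_range_projections_equiv:
  fixes e s t p q :: "'a::aw_star_algebra"
  assumes p: "p \<in> projections" "p * e = e" "e * p = p"
    and q: "q \<in> projections" "q * (s * e * t) = s * e * t" "(s * e * t) * q = q"
    and ts: "t * s = 1"
  shows "mvn_equiv p q"
proof -
  note pp = projectionsD[OF p(1)] and qq = projectionsD[OF q(1)]
  \<comment> \<open>\<open>a\<close> is invertible from the range of \<open>p\<close> to that of \<open>q\<close>, with inverse \<open>u\<close>;
    its polar part is \<open>a (a\<^sup>*a)\<^sup>-\<^sup>1\<^sup>/\<^sup>2 = a (uu\<^sup>*)\<^sup>1\<^sup>/\<^sup>2\<close>.\<close>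
  define a where "a = s * p"
  define u where "u = p * t * q"
  have "a = (s * e * t) * a"
    unfolding a_def by (metis ts p(3) mult.assoc mult.right_neutral)
  then have qa: "q * a = a" using q(2) by (metis mult.assoc)
  have ua: "u * a = p"
  proof -
    have "u * a = p * t * (q * a)" by (simp add: u_def mult.assoc)
    also have "\<dots> = p * (t * s) * p" unfolding qa by (simp add: a_def mult.assoc)
    finally show ?thesis by (simp add: ts pp)
  qed
  have au: "a * u = q"
  proof -
    have "a * u = s * p * t * q" by (simp add: a_def u_def mult.assoc) (metis pp(2) mult.assoc)
    also have "\<dots> = s * p * (t * s) * e * t * q" by (subst q(3)[symmetric]) (simp add: mult.assoc)
    also have "\<dots> = s * e * t * q" by (simp add: ts) (metis p(2) mult.assoc)
    finally show ?thesis by (simp add: q(3))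
  qed
  define y where "y = u * star u"
  define b where "b = star a * a"
  have "positive y" unfolding y_def by (rule positive_mult_star)
  then obtain k where k: "star k = k" "k * k = y" "k \<in> bicommutant y" by (rule positive_sqrt)
  have py: "p * y = y" by (simp add: y_def u_def flip: mult.assoc) (simp add: pp)
  have sy: "star y = y" by (simp add: y_def star_mult star_star)
  have yp: "y * p = y" using py sy pp(1) by (metis star_mult)
  have pk: "p * k = k * p" by (rule bicommutantD[OF k(3)]) (simp add: py yp)
  \<comment> \<open>\<open>b\<close> and \<open>y\<close> are inverse to each other in the corner of
    \<open>p\<close>. Hence \<open>k\<close>, which lies in the bicommutant of \<open>y\<close>,
    also commutes with \<open>b\<close> and acts there as its inverse square root.\<close>
  have "b * y = star a * (a * u) * star u" by (simp add: b_def y_def mult.assoc)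
  also have "\<dots> = star (u * (q * a))" by (simp add: au star_mult qq mult.assoc)
  finally have bby: "b * y = p" by (simp add: qa ua pp)
  have sb: "star b = b" by (simp add: b_def star_mult star_star)
  have yb: "y * b = p" using bby sb sy pp(1) by (metis star_mult)
  have bk: "b * k = k * b" by (rule bicommutantD[OF k(3)]) (simp add: bby yb)
  have ap: "a * p = a" by (simp add: a_def mult.assoc pp)
  have "star (a * k * p) * (a * k * p) = p * (k * b * k) * p"
    by (simp add: star_mult k b_def pp mult.assoc)
  also have "k * b * k = p" by (metis bk k(2) bby mult.assoc)
  finally have 1: "star (a * k * p) * (a * k * p) = p" by (simp add: pp)
  have "a * k * p = a * k" by (metis pk ap mult.assoc)
  then have "(a * k * p) * star (a * k * p) = a * y * star a"
    by (simp add: star_mult k mult.assoc) (metis k(2) mult.assoc)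
  also have "\<dots> = (a * u) * star (a * u)" by (simp add: y_def star_mult mult.assoc)
  finally have 2: "(a * k * p) * star (a * k * p) = q" by (simp add: au qq)
  show ?thesis unfolding mvn_equiv_def using 1 2 by metis
qed

theorem corollary7:
  fixes Q :: "'a::aw_star_factor_II1 \<Rightarrow> complex"
    and e s :: 'a
  assumes "is_quasi_trace Q"
    and "e * e = e"
    and "s \<in> GL"
  shows "Q (s * e * GL_inverse s) = Q e"
proof -
  obtain D where D: "dimension_function D"
    and Q: "\<And>x. Q x = complex_of_real (selfadjoint_trace D (re_part x))
              + \<i> * complex_of_real (selfadjoint_trace D (im_part x))"
    using assms(1) by (auto simp: is_quasi_trace_def)
  define f where "f = s * e * GL_inverse s"
  have inv: "GL_inverse s * s = 1" using assms(3) by (rule GL_inverse_mult)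
  have "f * f = s * (e * (GL_inverse s * s) * e) * GL_inverse s" by (simp add: f_def mult.assoc)
  then have "f * f = f" by (simp add: inv assms(2) f_def)
  then obtain q where q: "q \<in> projections" "q * f = f" "f * q = q" by (rule idempotent_range_projection)
  obtain p where p: "p \<in> projections" "p * e = e" "e * p = p"
    using idempotent_range_projection[OF assms(2)] .
  have "mvn_equiv p q" using similar_range_projections_equiv[OF p q[unfolded f_def] inv] .
  then have "D p = D q" by (rule dimension_functionD(2)[OF D p(1) q(1)])
  then show ?thesis
    unfolding f_def[symmetric] Q using idempotent_trace[OF D p] idempotent_trace[OF D q] by simp
qed

end
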